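(* Let $A$ be a discrete valuation ring with maximal ideal $\mathfrak m=tA$ and completion $\hat A$, let $z\in\hat A$ be an element satisfying the hypotheses of Akizuki's construction (stated in the context), and let $C_M$ be the resulting Akizuki local domain. Let $\sigma,\rho\in\hat A$, and let $$\Phi_{\sigma,\rho}\colon \mathrm H^1_{MC_M}(C_M)\to\operatorname{Hom}_A^c(C_M,K/A),\qquad \Phi_{\sigma,\rho}(\omega)(f)=\operatorname{res}_{\sigma,\rho}(f\omega)\quad(\omega\in \mathrm H^1_{MC_M}(C_M),\ f\in C_M),$$ be the $C_M$-linear map induced by the residue map $\operatorname{res}_{\sigma,\rho}$. If $\rho$ is invertible in $\hat A$, then $\Phi_{\sigma,\rho}$ is an isomorphism of $C_M$-modules.
   Context: Akizuki's construction. $A$ is a discrete valuation ring with maximal ideal $\mathfrak m=tA$, $\hat A$ is its completion, and $K$, $\hat K$ are the quotient fields of $A$, $\hat A$. Assume there is an element $z=a_0+a_1t^{n_1}+a_2t^{n_2}+\cdots\in\hat A$ with all $a_i\in A\setminus\mathfrak m$, transcendental over $A$, where $n_0=0$ and $n_r\ge 2n_{r-1}+2$ for all $r\ge 1$. For $r\ge 0$ put $z_r=a_r+a_{r+1}t^{n_{r+1}-n_r}+a_{r+2}t^{n_{r+2}-n_r}+\cdots\in\hat A$ (so $z_0=z$). Let $C=A[t(z_0-a_0),\{(z_i-a_i)^2\}_{i=0}^\infty]\subset\hat A$, let $M$ be the maximal ideal of $C$ generated by $t$ and $t(z_0-a_0)$, and let $C_M$ be the localization of $C$ at $M$. By Akizuki,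 $C_M$ is a one-dimensional Noetherian local domain; its quotient field is $K(z)=(C_M)_t$. Generalized fractions. The local cohomology module $\mathrm H^1_{MC_M}(C_M)$ is identified with $(C_M)_t/C_M$ via the exact sequence $0\to C_M\to (C_M)_t\to \mathrm H^1_{MC_M}(C_M)\to 0$. For $f\in C_M$ and $n>0$, $\left[\begin{smallmatrix} f\\ t^n\end{smallmatrix}\right]_{C_M}$ denotes the image of $f/t^n$ in $\mathrm H^1_{MC_M}(C_M)$. For $f\in\hat A$ and $n>0$, $\left[\begin{smallmatrix} f\\ t^n\end{smallmatrix}\right]_{A}$ denotes the image of $f/t^n$ in $\hat K/\hat A$, and also the corresponding element of $K/A$ under the canonical isomorphism $K/A\to\hat K/\hat A$. Residue maps. Every element of $\mathrm H^1_{MC_M}(C_M)$ can be written as $\left[\begin{smallmatrix} X+Yt(z_0-a_0)\\ t^n\end{smallmatrix}\right]_{C_M}$ with $X,Y\in A$. For $\sigma,\rho\in\hat A$, $\operatorname{res}_{\sigma,\rho}\colon \mathrm H^1_{MC_M}(C_M)\to K/A$ is the (well-defined) $A$-linear map with $$\left[\begin{smallmatrix} X+Yt(z_0-a_0)\\ t^n\end{smallmatrix}\right]_{C_M}\mapsto\left[\begin{smallmatrix} X\sigma+Y\rho\\ t^n\end{smallmatrix}\right]_{A}\qquad(X,Y\in A).$$ Continuous homomorphisms. $\operatorname{Hom}_A^c(C_M,K/A)=\{\varphi\in\operatorname{Hom}_A(C_M,K/A)\mid \varphi(M^nC_M)=0\text{ for some }n\}$, a $C_M$-module via $(g\varphi)(f)=\varphi(gf)$.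 *)

theory Defs
  imports
    "HOL-Algebra.Module"
    "HOL-Algebra.Ideal_Product"
    "HOL-Algebra.Generated_Rings"
    "HOL-Algebra.Finite_Extensions"
begin

text \<open>
  All rings of the construction are subrings of one ambient field, the quotient field of the
  completion; it is a type \<open>'k\<close> of class \<open>field\<close>, and subrings are sets over \<open>'k\<close>.
  \<open>embedded S\<close> is such a set \<open>S\<close> with the inherited operations; its scalar multiplication makes
  it a module over every subring contained in it.
\<close>

definition embedded :: "'k::field set \<Rightarrow> ('k, 'k) module" where
  "embedded S = \<lparr>carrier = S, monoid.mult = (*), one = 1, zero = 0, add = (+), smult = (*)\<rparr>"

definition fractions :: "'k::field set \<Rightarrow> 'k set" where
  "fractions S = {x / y | x y. x \<in> S \<and> y \<in> S \<and> y \<noteq> 0}"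

definition localization_at :: "'k::field set \<Rightarrow> 'k set \<Rightarrow> 'k set" where
  "localization_at S P = {f / g | f g. f \<in> S \<and> g \<in> S - P}"

definition localization_away :: "'k::field set \<Rightarrow> 'k \<Rightarrow> 'k set" where
  "localization_away S t = {f / t ^ m | f m. f \<in> S}"


section \<open>Modules\<close>

text \<open>
  The fields \<open>mult\<close> and \<open>one\<close> of a module record carry no meaning. As in \<open>FactRing\<close>, cosets are
  sets, and the scalar multiple of a coset is the (unique) coset of the multiples of its members.
\<close>

definition quotient_module :: "('r, 'b, 'm) module_scheme \<Rightarrow> 'b set \<Rightarrow> ('r, 'b set) module" where
  "quotient_module M N =
     \<lparr>carrier = a_rcosets\<^bsub>M\<^esub> N, monoid.mult = undefined, one = undefined,
      zero = N, add = (\<lambda>c d. c <+>\<^bsub>M\<^esub> d),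
      smult = (\<lambda>r c. \<Union>x\<in>c. N +>\<^bsub>M\<^esub> (r \<odot>\<^bsub>M\<^esub> x))\<rparr>"

definition module_homs ::
  "('r, 'q) ring_scheme \<Rightarrow> ('r, 'b, 'm) module_scheme \<Rightarrow> ('r, 'c, 'n) module_scheme \<Rightarrow> ('b \<Rightarrow> 'c) set"
  where
  "module_homs R M N = {h \<in> carrier M \<rightarrow>\<^sub>E carrier N.
     (\<forall>x\<in>carrier M. \<forall>y\<in>carrier M. h (x \<oplus>\<^bsub>M\<^esub> y) = h x \<oplus>\<^bsub>N\<^esub> h y) \<and>
     (\<forall>r\<in>carrier R. \<forall>x\<in>carrier M. h (r \<odot>\<^bsub>M\<^esub> x) = r \<odot>\<^bsub>N\<^esub> h x)}"

definition module_isos ::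
  "('r, 'q) ring_scheme \<Rightarrow> ('r, 'b, 'm) module_scheme \<Rightarrow> ('r, 'c, 'n) module_scheme \<Rightarrow> ('b \<Rightarrow> 'c) set"
  where
  "module_isos R M N = {h \<in> module_homs R M N. bij_betw h (carrier M) (carrier N)}"


section \<open>Discrete valuation rings and completion\<close>

definition discrete_valuation_ring :: "('a, 'm) ring_scheme \<Rightarrow> bool" where
  "discrete_valuation_ring R \<longleftrightarrow>
     principal_domain R \<and> \<not> Ring.field R \<and> (\<exists>!I. maximalideal I R)"

text \<open>\<open>adic_nbhd t k S\<close> is the ideal \<open>t\<^sup>k S\<close>.\<close>

definition adic_nbhd :: "'k::field \<Rightarrow> nat \<Rightarrow> 'k set \<Rightarrow> 'k set" where
  "adic_nbhd t k S = (\<lambda>x. t ^ k * x) ` S"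

definition adic_lim :: "'k::field set \<Rightarrow> 'k \<Rightarrow> (nat \<Rightarrow> 'k) \<Rightarrow> 'k \<Rightarrow> bool" where
  "adic_lim S t u l \<longleftrightarrow> l \<in> S \<and> (\<forall>k. \<exists>N. \<forall>i\<ge>N. u i - l \<in> adic_nbhd t k S)"

definition adic_Cauchy :: "'k::field set \<Rightarrow> 'k \<Rightarrow> (nat \<Rightarrow> 'k) \<Rightarrow> bool" where
  "adic_Cauchy S t u \<longleftrightarrow>
     range u \<subseteq> S \<and> (\<forall>k. \<exists>N. \<forall>i\<ge>N. \<forall>j\<ge>N. u i - u j \<in> adic_nbhd t k S)"

definition adic_sums :: "'k::field set \<Rightarrow> 'k \<Rightarrow> (nat \<Rightarrow> 'k) \<Rightarrow> 'k \<Rightarrow> bool" where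
  "adic_sums S t u s \<longleftrightarrow> adic_lim S t (\<lambda>m. \<Sum>i<m. u i) s"

text \<open>
  \<open>R\<close> is the \<open>t\<close>-adic completion of its subring \<open>A\<close>: the topology of \<open>A\<close> is the one induced
  from \<open>R\<close>, and \<open>R\<close> is Hausdorff and complete with \<open>A\<close> dense in it.
\<close>

definition is_adic_completion :: "'k::field set \<Rightarrow> 'k \<Rightarrow> 'k set \<Rightarrow> bool" where
  "is_adic_completion A t R \<longleftrightarrow>
     subring R (embedded UNIV) \<and> subring A (embedded R) \<and>
     (\<forall>k. adic_nbhd t k R \<inter> A = adic_nbhd t k A) \<and>
     (\<Inter>k. adic_nbhd t k R) = {0} \<and>
     (\<forall>x\<in>R. \<forall>k. \<exists>y\<in>A. x - y \<in> adic_nbhd t k R) \<and>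
     (\<forall>u. adic_Cauchy R t u \<longrightarrow> (\<exists>l. adic_lim R t u l))"


section \<open>Akizuki's ring\<close>

definition tail_sum :: "'k::field set \<Rightarrow> 'k \<Rightarrow> (nat \<Rightarrow> 'k) \<Rightarrow> (nat \<Rightarrow> nat) \<Rightarrow> nat \<Rightarrow> 'k" where
  "tail_sum Ahat t a n r =
     (THE s. adic_sums Ahat t (\<lambda>i. a (r + i) * t ^ (n (r + i) - n r)) s)"

definition akizuki_w :: "'k::field set \<Rightarrow> 'k \<Rightarrow> (nat \<Rightarrow> 'k) \<Rightarrow> (nat \<Rightarrow> nat) \<Rightarrow> 'k" where
  "akizuki_w Ahat t a n = t * (tail_sum Ahat t a n 0 - a 0)"

definition akizuki_C ::
  "'k::field set \<Rightarrow> 'k set \<Rightarrow> 'k \<Rightarrow> (nat \<Rightarrow> 'k) \<Rightarrow> (nat \<Rightarrow> nat) \<Rightarrow> 'k set" where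
  "akizuki_C A Ahat t a n =
     generate_ring (embedded Ahat)
       (A \<union> {akizuki_w Ahat t a n} \<union> range (\<lambda>i. (tail_sum Ahat t a n i - a i) ^ 2))"

definition akizuki_M ::
  "'k::field set \<Rightarrow> 'k set \<Rightarrow> 'k \<Rightarrow> (nat \<Rightarrow> 'k) \<Rightarrow> (nat \<Rightarrow> nat) \<Rightarrow> 'k set" where
  "akizuki_M A Ahat t a n =
     Idl\<^bsub>embedded (akizuki_C A Ahat t a n)\<^esub> {t, akizuki_w Ahat t a n}"

definition akizuki_CM ::
  "'k::field set \<Rightarrow> 'k set \<Rightarrow> 'k \<Rightarrow> (nat \<Rightarrow> 'k) \<Rightarrow> (nat \<Rightarrow> nat) \<Rightarrow> 'k set" where
  "akizuki_CM A Ahat t a n =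
     localization_at (akizuki_C A Ahat t a n) (akizuki_M A Ahat t a n)"

text \<open>The extension to \<open>C\<^sub>M\<close> of the power \<open>M\<^sup>m\<close>, formed in the monoid of ideals of \<open>C\<close>.\<close>

definition akizuki_MpowCM ::
  "'k::field set \<Rightarrow> 'k set \<Rightarrow> 'k \<Rightarrow> (nat \<Rightarrow> 'k) \<Rightarrow> (nat \<Rightarrow> nat) \<Rightarrow> nat \<Rightarrow> 'k set" where
  "akizuki_MpowCM A Ahat t a n m =
     Idl\<^bsub>embedded (akizuki_CM A Ahat t a n)\<^esub>
       (akizuki_M A Ahat t a n [^]\<^bsub>ideals_set (embedded (akizuki_C A Ahat t a n))\<^esub> m)"


section \<open>Local cohomology, generalized fractions and residue maps\<close>

text \<open>The local cohomology module, under its identification with \<open>(C\<^sub>M)\<^sub>t / C\<^sub>M\<close>.\<close>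

definition akizuki_H1 ::
  "'k::field set \<Rightarrow> 'k set \<Rightarrow> 'k \<Rightarrow> (nat \<Rightarrow> 'k) \<Rightarrow> (nat \<Rightarrow> nat) \<Rightarrow> ('k, 'k set) module" where
  "akizuki_H1 A Ahat t a n =
     quotient_module (embedded (localization_away (akizuki_CM A Ahat t a n) t))
       (akizuki_CM A Ahat t a n)"

definition genfrac_CM ::
  "'k::field set \<Rightarrow> 'k set \<Rightarrow> 'k \<Rightarrow> (nat \<Rightarrow> 'k) \<Rightarrow> (nat \<Rightarrow> nat) \<Rightarrow> 'k \<Rightarrow> nat \<Rightarrow> 'k set" where
  "genfrac_CM A Ahat t a n f m =
     akizuki_CM A Ahat t a n
       +>\<^bsub>embedded (localization_away (akizuki_CM A Ahat t a n) t)\<^esub> (f / t ^ m)"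

definition frac_quotient :: "'k::field set \<Rightarrow> ('k, 'k set) module" where
  "frac_quotient S = quotient_module (embedded (fractions S)) S"

text \<open>The canonical map from \<open>K / A\<close> to the corresponding quotient for the completion.\<close>

definition frac_quotient_map :: "'k::field set \<Rightarrow> 'k set \<Rightarrow> 'k set" where
  "frac_quotient_map Ahat c = Ahat <+>\<^bsub>embedded (fractions Ahat)\<^esub> c"

definition genfrac_A :: "'k::field set \<Rightarrow> 'k set \<Rightarrow> 'k \<Rightarrow> 'k \<Rightarrow> nat \<Rightarrow> 'k set" where
  "genfrac_A A Ahat t f m =
     the_inv_into (carrier (frac_quotient A)) (frac_quotient_map Ahat)
       (Ahat +>\<^bsub>embedded (fractions Ahat)\<^esub> (f / t ^ m))"

definition akizuki_res ::
  "'k::field set \<Rightarrow> 'k set \<Rightarrow> 'k \<Rightarrow> (nat \<Rightarrow> 'k) \<Rightarrow> (nat \<Rightarrow> nat) \<Rightarrow> 'k \<Rightarrow> 'k \<Rightarrow> 'k set \<Rightarrow> 'k set"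
  where
  "akizuki_res A Ahat t a n \<sigma> \<rho> \<omega> =
     (THE \<eta>. \<exists>x\<in>A. \<exists>y\<in>A. \<exists>m>0.
        \<omega> = genfrac_CM A Ahat t a n (x + y * akizuki_w Ahat t a n) m \<and>
        \<eta> = genfrac_A A Ahat t (x * \<sigma> + y * \<rho>) m)"

definition akizuki_Homc ::
  "'k::field set \<Rightarrow> 'k set \<Rightarrow> 'k \<Rightarrow> (nat \<Rightarrow> 'k) \<Rightarrow> (nat \<Rightarrow> nat) \<Rightarrow> ('k, 'k \<Rightarrow> 'k set) module" where
  "akizuki_Homc A Ahat t a n =
     \<lparr>carrier =
        {\<phi> \<in> module_homs (embedded A) (embedded (akizuki_CM A Ahat t a n)) (frac_quotient A).
           \<exists>m. \<forall>f\<in>akizuki_MpowCM A Ahat t a n m. \<phi> f = \<zero>\<^bsub>frac_quotient A\<^esub>},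
      monoid.mult = undefined, one = undefined,
      zero = (\<lambda>f\<in>akizuki_CM A Ahat t a n. \<zero>\<^bsub>frac_quotient A\<^esub>),
      add = (\<lambda>\<phi> \<psi>. \<lambda>f\<in>akizuki_CM A Ahat t a n. \<phi> f \<oplus>\<^bsub>frac_quotient A\<^esub> \<psi> f),
      smult = (\<lambda>g \<phi>. \<lambda>f\<in>akizuki_CM A Ahat t a n. \<phi> (g * f))\<rparr>"

definition akizuki_Phi ::
  "'k::field set \<Rightarrow> 'k set \<Rightarrow> 'k \<Rightarrow> (nat \<Rightarrow> 'k) \<Rightarrow> (nat \<Rightarrow> nat) \<Rightarrow> 'k \<Rightarrow> 'k
     \<Rightarrow> 'k set \<Rightarrow> 'k \<Rightarrow> 'k set" where
  "akizuki_Phi A Ahat t a n \<sigma> \<rho> =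
     (\<lambda>\<omega>\<in>carrier (akizuki_H1 A Ahat t a n). \<lambda>f\<in>akizuki_CM A Ahat t a n.
        akizuki_res A Ahat t a n \<sigma> \<rho> (f \<odot>\<^bsub>akizuki_H1 A Ahat t a n\<^esub> \<omega>))"

end

theory Submission
  imports Defs "HOL-Computational_Algebra.Polynomial"
begin

text \<open>
  Put \<open>w = t(z\<^sub>0 - a\<^sub>0)\<close>. Then \<open>w\<^sup>2\<close> lies in \<open>t\<^sup>2C\<close>, and \<open>C\<^sub>M = A + Aw + t\<^sup>mC\<^sub>M\<close> for all \<open>m\<close>; as \<open>z\<close>
  is transcendental, \<open>1\<close> and \<open>w\<close> are even a basis of \<open>C\<^sub>M / t\<^sup>mC\<^sub>M\<close> over \<open>A / t\<^sup>mA\<close>. Injectivity is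
  checked on the socle, that is on classes \<open>(X + Yw) / t\<close>, where the residues of the class and of
  its multiple by \<open>w\<close> give \<open>X\<rho>\<close> and \<open>X\<sigma> + Y\<rho>\<close> modulo \<open>t\<close>. Surjectivity is a \<open>2 \<times> 2\<close> linear system
  over the completion whose determinant is \<open>-\<rho>\<^sup>2\<close> modulo \<open>t\<close>.
\<close>

section \<open>Subrings of a field as sets\<close>

text \<open>The obstacle is that divisibility by \<open>t\<close> in \<open>C_M\<close> is finer
  than in the completion: \<open>w / t\<close> is z - a_0, an element of the completion that does
  not lie in \<open>C_M\<close>. Membership in \<open>C_M\<close> can therefore not be tested by a
  valuation, and \<open>C\<close> has infinitely many generators. The growth of the exponents helps
  twice. It rewrites each square (z_i - a_i)^2 as \<open>t\<close> times a combination of 1,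
  \<open>w\<close> and the next square, so that modulo \<open>t\<close> only 1 and \<open>w\<close>
  survive. Read in the other direction, it puts any finite set of elements of \<open>C\<close> into
  one ring A[w, s^2] with s = z_N - a_N, where \<open>w\<close> is a power of \<open>t\<close> times
  s up to a multiple of \<open>t\<close> in \<open>A\<close>. Transcendence separates the even from
  the odd polynomials in s, and comparing odd parts shows that \<open>w / t\<close> is not a
  fraction with denominator outside \<open>M\<close>. Modulo \<open>t\<close>, multiplication by
  \<open>w\<close> sends 1 to \<open>w\<close> and \<open>w\<close> to 0; this nilpotent action is
  what puts \<open>\<rho>\<close> on the antidiagonal of the pairing.\<close>

lemma embedded_simps [simp]:
  "carrier (embedded S) = S" "monoid.mult (embedded S) = (*)" "one (embedded S) = 1"
  "zero (embedded S) = 0" "add (embedded S) = (+)" "module.smult (embedded S) = (*)"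
  by (simp_all add: embedded_def)

text \<open>Closure under subtraction yields zero, negatives and sums at once. Sets inside a field
  leave division available even where the quotient falls outside the ring.\<close>

locale field_subring =
  fixes S :: "'k::field set"
  assumes one_mem [simp]: "1 \<in> S"
    and diff_mem: "x \<in> S \<Longrightarrow> y \<in> S \<Longrightarrow> x - y \<in> S"
    and mult_mem: "x \<in> S \<Longrightarrow> y \<in> S \<Longrightarrow> x * y \<in> S"
begin

lemma zero_mem [simp]: "0 \<in> S"
  using diff_mem[OF one_mem one_mem] by simp

lemma minus_mem: "x \<in> S \<Longrightarrow> - x \<in> S"
  using diff_mem[OF zero_mem, of x] by simp

lemma add_mem: "x \<in> S \<Longrightarrow> y \<in> S \<Longrightarrow> x + y \<in> S"
  using diff_mem[of x "- y"] minus_mem[of y] by simp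

lemma power_mem: "x \<in> S \<Longrightarrow> x ^ m \<in> S"
  by (induction m) (simp_all add: mult_mem)

lemma sum_mem: "(\<And>i. i \<in> I \<Longrightarrow> f i \<in> S) \<Longrightarrow> sum f I \<in> S"
  by (induction I rule: infinite_finite_induct) (simp_all add: add_mem)

lemma mult_power_mem: "x \<in> S \<Longrightarrow> c \<in> S \<Longrightarrow> c ^ m * x \<in> S"
  by (intro mult_mem power_mem)

lemma two_mem [simp]: "2 \<in> S"
  using add_mem[OF one_mem one_mem] by simp

lemma cring_embedded: "cring (embedded S)"
proof (rule cringI)
  show "abelian_group (embedded S)"
  proof (rule abelian_groupI)
    show "\<exists>y\<in>carrier (embedded S). y \<oplus>\<^bsub>embedded S\<^esub> x = \<zero>\<^bsub>embedded S\<^esub>"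
      if "x \<in> carrier (embedded S)" for x
      by (rule bexI[of _ "- x"]) (use that minus_mem in auto)
  qed (auto simp: algebra_simps add_mem)
  show "Group.comm_monoid (embedded S)"
    by (rule comm_monoidI) (auto simp: mult_mem)
qed (auto simp: algebra_simps)

lemma a_inv_embedded [simp]: "x \<in> S \<Longrightarrow> \<ominus>\<^bsub>embedded S\<^esub> x = - x"
proof -
  interpret cring "embedded S" by (rule cring_embedded)
  assume "x \<in> S"
  then show ?thesis
    using minus_equality[of "- x" x] minus_mem[of x] by simp
qed

lemma ideal_embedded:
  assumes "I \<subseteq> S" "0 \<in> I" "\<And>x y. x \<in> I \<Longrightarrow> y \<in> I \<Longrightarrow> x + y \<in> I"
    "\<And>c x. c \<in> S \<Longrightarrow> x \<in> I \<Longrightarrow> c * x \<in> I"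
  shows "ideal I (embedded S)"
proof -
  interpret cring "embedded S" by (rule cring_embedded)
  show ?thesis
  proof (rule idealI)
    show "subgroup I (add_monoid (embedded S))"
    proof (rule add.subgroupI)
      show "\<ominus>\<^bsub>embedded S\<^esub> x \<in> I" if "x \<in> I" for x
      proof -
        have "\<ominus>\<^bsub>embedded S\<^esub> x = - 1 * x"
          using a_inv_embedded[of x] assms(1) that by auto
        then show ?thesis
          using assms(4)[OF minus_mem[OF one_mem] that] by (simp only:)
      qed
    qed (use assms in auto)
    show "x \<otimes>\<^bsub>embedded S\<^esub> c \<in> I" "c \<otimes>\<^bsub>embedded S\<^esub> x \<in> I" if "x \<in> I" "c \<in> carrier (embedded S)" for x c
      using that assms(4) by (auto simp: mult.commute)
  qed (rule ring_axioms)
qed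

lemma generate_ring_least:
  assumes "field_subring T" "T \<subseteq> S" "H \<subseteq> T"
  shows "generate_ring (embedded S) H \<subseteq> T"
proof
  interpret T: field_subring T by fact
  fix x assume "x \<in> generate_ring (embedded S) H"
  then show "x \<in> T"
  proof induction
    case (a_inv h)
    then show ?case using assms(2) T.minus_mem by (simp add: subsetD)
  qed (use assms T.add_mem T.mult_mem in auto)
qed

lemma field_subring_generate_ring:
  assumes "H \<subseteq> S"
  shows "field_subring (generate_ring (embedded S) H)"
proof
  interpret cring "embedded S" by (rule cring_embedded)
  show "1 \<in> generate_ring (embedded S) H"
    using generate_ring.one[of "embedded S" H] by simp
  show mult: "x * y \<in> generate_ring (embedded S) H"
    if "x \<in> generate_ring (embedded S) H" "y \<in> generate_ring (embedded S) H" for x y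
    using generate_ring.eng_mult[OF that] by simp
  fix x y assume x: "x \<in> generate_ring (embedded S) H" and y: "y \<in> generate_ring (embedded S) H"
  have "y \<in> S"
    using generate_ring_in_carrier[of H y] assms y by simp
  then have "- y \<in> generate_ring (embedded S) H"
    using generate_ring.a_inv[OF y] by simp
  then show "x - y \<in> generate_ring (embedded S) H"
    using generate_ring.eng_add[OF x, of "- y"] by simp
qed

end

lemma field_subringI:
  assumes "subring S (embedded T)" "field_subring T"
  shows "field_subring S"
proof
  interpret T: field_subring T by fact
  interpret subring S "embedded T" by fact
  show "1 \<in> S" using one_closed by simp
  show "x * y \<in> S" if "x \<in> S" "y \<in> S" for x y
    using that m_closed by simp
  show "x - y \<in> S" if "x \<in> S" "y \<in> S" for x y
  proof -
    have "y \<in> T" using that subset by auto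
    then have "- y \<in> S"
      using m_inv_closed[OF that(2)] T.a_inv_embedded[of y] by (simp only: a_inv_def)
    then show ?thesis
      using subringE(7)[OF assms(1) that(1), of "- y"] by simp
  qed
qed

lemma field_subring_UNIV: "field_subring UNIV"
  by unfold_locales auto


section \<open>Quotient modules\<close>

lemma a_r_coset_embedded: "N +>\<^bsub>embedded L\<^esub> x = (\<lambda>c. c + x) ` N"
  by (auto simp: a_r_coset_def r_coset_def)

lemma carrier_quotient_module:
  "carrier (quotient_module (embedded L) N) = (\<lambda>x. N +>\<^bsub>embedded L\<^esub> x) ` L"
  by (auto simp: quotient_module_def A_RCOSETS_def RCOSETS_def a_r_coset_def)

context field_subring
begin

lemma mem_coset_iff: "y \<in> S +>\<^bsub>embedded L\<^esub> x \<longleftrightarrow> y - x \<in> S"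
  unfolding a_r_coset_embedded by (auto intro!: image_eqI[of _ _ "y - x"])

lemma coset_eq_iff: "S +>\<^bsub>embedded L\<^esub> x = S +>\<^bsub>embedded L\<^esub> y \<longleftrightarrow> x - y \<in> S"
proof
  assume "S +>\<^bsub>embedded L\<^esub> x = S +>\<^bsub>embedded L\<^esub> y"
  then show "x - y \<in> S"
    using mem_coset_iff[of x L x] mem_coset_iff[of x L y] by simp
next
  assume xy: "x - y \<in> S"
  have "c - x \<in> S \<longleftrightarrow> c - y \<in> S" for c
    using add_mem[OF _ xy, of "c - x"] diff_mem[OF _ xy, of "c - y"] by auto
  then show "S +>\<^bsub>embedded L\<^esub> x = S +>\<^bsub>embedded L\<^esub> y"
    by (auto simp: mem_coset_iff)
qed

lemma coset_zero: "S +>\<^bsub>embedded L\<^esub> 0 = S"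
  by (simp add: a_r_coset_embedded)

text \<open>With \<open>A\<close> for \<open>T\<close> and the completion for \<open>S\<close> this
  evaluates \<open>frac_quotient_map\<close>. The ambient sets may differ because cosets use the
  addition alone.\<close>

lemma coset_add:
  assumes "T \<subseteq> S" "0 \<in> T"
  shows "S <+>\<^bsub>embedded L'\<^esub> (T +>\<^bsub>embedded L\<^esub> x) = S +>\<^bsub>embedded L''\<^esub> x"
proof -
  have "S <+>\<^bsub>embedded L'\<^esub> (T +>\<^bsub>embedded L\<^esub> x) = {c + (d + x) | c d. c \<in> S \<and> d \<in> T}"
    by (auto simp: set_add_def set_mult_def a_r_coset_embedded)
  also have "\<dots> = (\<lambda>c. c + x) ` S"
  proof (intro equalityI subsetI)
    fix y assume "y \<in> {c + (d + x) | c d. c \<in> S \<and> d \<in> T}"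
    then obtain c d where cd: "y = c + (d + x)" "c \<in> S" "d \<in> T"
      by blast
    then have "y = (c + d) + x" "c + d \<in> S"
      using assms(1) add_mem[of c d] by (simp_all add: add.assoc subsetD)
    then show "y \<in> (\<lambda>c. c + x) ` S"
      by (rule image_eqI)
  next
    fix y assume "y \<in> (\<lambda>c. c + x) ` S"
    then obtain c where "y = c + (0 + x)" "c \<in> S"
      by auto
    then show "y \<in> {c + (d + x) | c d. c \<in> S \<and> d \<in> T}"
      using assms(2) by blast
  qed
  finally show ?thesis by (simp add: a_r_coset_embedded)
qed

lemma quotient_add:
  "(S +>\<^bsub>embedded L\<^esub> x) \<oplus>\<^bsub>quotient_module (embedded L) S\<^esub> (S +>\<^bsub>embedded L\<^esub> y)
     = S +>\<^bsub>embedded L\<^esub> (x + y)"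
proof -
  have "(S +>\<^bsub>embedded L\<^esub> x) <+>\<^bsub>embedded L\<^esub> (S +>\<^bsub>embedded L\<^esub> y)
      = {(c + x) + (d + y) | c d. c \<in> S \<and> d \<in> S}"
    by (auto simp: set_add_def set_mult_def a_r_coset_embedded)
  also have "\<dots> = (\<lambda>c. c + (x + y)) ` S"
  proof (intro equalityI subsetI)
    fix v assume "v \<in> {(c + x) + (d + y) | c d. c \<in> S \<and> d \<in> S}"
    then obtain c d where cd: "v = (c + x) + (d + y)" "c \<in> S" "d \<in> S"
      by blast
    then have "v = (c + d) + (x + y)" "c + d \<in> S"
      using add_mem[of c d] by (simp_all add: algebra_simps)
    then show "v \<in> (\<lambda>c. c + (x + y)) ` S"
      by (rule image_eqI)
  next
    fix v assume "v \<in> (\<lambda>c. c + (x + y)) ` S"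
    then obtain c where "v = (c + x) + (0 + y)" "c \<in> S"
      by (auto simp: add.assoc)
    then show "v \<in> {(c + x) + (d + y) | c d. c \<in> S \<and> d \<in> S}"
      using zero_mem by blast
  qed
  finally show ?thesis by (simp add: quotient_module_def a_r_coset_embedded)
qed

lemma quotient_smult:
  assumes "c \<in> S"
  shows "c \<odot>\<^bsub>quotient_module (embedded L) S\<^esub> (S +>\<^bsub>embedded L\<^esub> x)
     = S +>\<^bsub>embedded L\<^esub> (c * x)"
proof -
  have "S +>\<^bsub>embedded L\<^esub> (c * y) = S +>\<^bsub>embedded L\<^esub> (c * x)" if "y \<in> S +>\<^bsub>embedded L\<^esub> x" for y
    using mult_mem[OF assms, of "y - x"] that
    by (simp add: coset_eq_iff mem_coset_iff right_diff_distrib)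
  moreover have "x \<in> S +>\<^bsub>embedded L\<^esub> x"
    by (simp add: mem_coset_iff)
  ultimately have "(\<Union>y\<in>S +>\<^bsub>embedded L\<^esub> x. S +>\<^bsub>embedded L\<^esub> (c * y)) = S +>\<^bsub>embedded L\<^esub> (c * x)"
    by (intro UN_constant_eq) blast+
  then show ?thesis
    by (simp add: quotient_module_def)
qed

end

section \<open>Discrete valuation rings and their completions\<close>

lemma mem_adic_nbhd_iff: "t \<noteq> 0 \<Longrightarrow> x \<in> adic_nbhd t k S \<longleftrightarrow> x / t ^ k \<in> S"
  unfolding adic_nbhd_def by (auto intro!: image_eqI[of _ _ "x / t ^ k"])

text \<open>Membership in the ideal generated by \<open>t ^ k\<close> is written as
  \<open>x / t ^ k\<close> lying in the ring; \<open>unit_A\<close> is locality in this form.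
  \<open>restricted\<close> speaks of one factor \<open>t\<close>, and
  \<open>restricted_power\<close> extends it by induction.\<close>

locale complete_dvr = A: field_subring A + R: field_subring R for A R :: "'k::field set" +
  fixes t :: 'k
  assumes A_subset: "A \<subseteq> R"
    and t_mem: "t \<in> A"
    and t_nonzero [simp]: "t \<noteq> 0"
    and t_nonunit: "inverse t \<notin> A"
    and unit_A: "x \<in> A \<Longrightarrow> x / t \<notin> A \<Longrightarrow> inverse x \<in> A"
    and restricted: "x \<in> A \<Longrightarrow> x / t \<in> R \<Longrightarrow> x / t \<in> A"
    and Hausdorff: "(\<And>k. x / t ^ k \<in> R) \<Longrightarrow> x = 0"
    and dense: "x \<in> R \<Longrightarrow> \<exists>y\<in>A. (x - y) / t ^ k \<in> R"
    and complete: "adic_Cauchy R t u \<Longrightarrow> \<exists>l. adic_lim R t u l"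
    and ambient: "fractions R = UNIV"
begin

lemma mem_R: "x \<in> A \<Longrightarrow> x \<in> R"
  using A_subset by blast

lemma t_mem_R [simp]: "t \<in> R"
  using t_mem by (rule mem_R)

lemma div_power_mono: "x / t ^ k \<in> R \<Longrightarrow> j \<le> k \<Longrightarrow> x / t ^ j \<in> R"
  using R.mult_power_mem[of "x / t ^ k" t "k - j"] by (simp add: power_diff)

lemma restricted_power: "x \<in> A \<Longrightarrow> x / t ^ k \<in> R \<Longrightarrow> x / t ^ k \<in> A"
proof (induction k)
  case (Suc k)
  then have "x / t ^ k \<in> A"
    using div_power_mono[of x "Suc k" k] by simp
  then show ?case
    using restricted[of "x / t ^ k"] Suc.prems by (simp add: field_simps)
qed simp

lemma inverse_t_notin_R: "inverse t \<notin> R"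
  using restricted[of 1] t_nonunit by (auto simp: inverse_eq_divide)

text \<open>The inverse is the limit of the geometric series in \<open>t * x\<close>; this is where
  completeness of \<open>R\<close> enters.\<close>

lemma inverse_one_minus:
  assumes x: "x \<in> R"
  shows "inverse (1 - t * x) \<in> R"
proof -
  have nz: "1 - t * x \<noteq> 0"
  proof
    assume "1 - t * x = 0"
    then have "inverse t = x"
      using inverse_unique[of t x] by simp
    then show False
      using x inverse_t_notin_R by simp
  qed
  define u where "u = (\<lambda>i. \<Sum>j<i. (t * x) ^ j)"
  have u_mem: "u i \<in> R" for i
    unfolding u_def by (intro R.sum_mem R.power_mem R.mult_mem x t_mem_R)
  have u_Suc: "u (Suc i) = u i + (t * x) ^ i" for i
    by (simp add: u_def)
  have pow: "(t * x) ^ i / t ^ k \<in> R" if "k \<le> i" for i k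
  proof -
    have "(t * x) ^ i / t ^ k = t ^ (i - k) * x ^ i"
      using that by (simp add: power_mult_distrib power_diff)
    then show ?thesis
      using R.mult_power_mem[OF R.power_mem[OF x] t_mem_R] by simp
  qed
  have diff: "(u i - u k) / t ^ k \<in> R" if "k \<le> i" for i k
    using that
  proof (induction i rule: dec_induct)
    case (step i)
    have "(u (Suc i) - u k) / t ^ k = (u i - u k) / t ^ k + (t * x) ^ i / t ^ k"
      by (simp add: u_Suc field_simps)
    then show ?case
      using R.add_mem[OF step.IH pow[OF step.hyps(1)]] by simp
  qed simp
  have "adic_Cauchy R t u"
    unfolding adic_Cauchy_def
  proof (intro conjI allI)
    fix k
    have "u i - u j \<in> adic_nbhd t k R" if "i \<ge> k" "j \<ge> k" for i j
      using R.diff_mem[OF diff[OF that(1)] diff[OF that(2)]]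
      by (simp add: mem_adic_nbhd_iff diff_divide_distrib[symmetric])
    then show "\<exists>N. \<forall>i\<ge>N. \<forall>j\<ge>N. u i - u j \<in> adic_nbhd t k R"
      by blast
  qed (use u_mem in auto)
  then obtain l where l: "adic_lim R t u l"
    using complete by blast
  \<comment> \<open>The Hausdorff property reduces the identity to one modulo each
    \<open>t ^ k\<close>, where a late partial sum replaces \<open>l\<close> and
    \<open>(t * x) ^ i\<close> is divisible by \<open>t ^ k\<close>.\<close>
  have "(1 - t * x) * l - 1 = 0"
  proof (rule Hausdorff)
    fix k
    obtain N where N: "\<And>i. i \<ge> N \<Longrightarrow> (u i - l) / t ^ k \<in> R"
      using l unfolding adic_lim_def mem_adic_nbhd_iff[OF t_nonzero] by blast
    define i where "i = max N k"
    have "1 - (t * x) ^ i = (1 - t * x) * u i"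
      unfolding u_def by (rule one_diff_power_eq)
    then have "(1 - t * x) * l - 1 = - ((1 - t * x) * (u i - l)) - (t * x) ^ i"
      by (simp add: algebra_simps)
    then have "((1 - t * x) * l - 1) / t ^ k
        = - ((1 - t * x) * ((u i - l) / t ^ k)) - (t * x) ^ i / t ^ k"
      by (simp only: diff_divide_distrib[of "- ((1 - t * x) * (u i - l))"]
          minus_divide_left times_divide_eq_right)
    also have "\<dots> \<in> R"
      using N[of i] pow[of k i] x
      by (intro R.diff_mem R.minus_mem R.mult_mem) (auto simp: i_def)
    finally show "((1 - t * x) * l - 1) / t ^ k \<in> R" .
  qed
  then have "inverse (1 - t * x) = l"
    by (intro inverse_unique) simp
  then show ?thesis
    using l by (simp add: adic_lim_def)
qed

text \<open>An element \<open>y\<close> of \<open>A\<close> congruent to \<open>x\<close> modulo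
  \<open>t\<close> is a unit of \<open>A\<close>, and \<open>x / y\<close> has the form
  \<open>1 - t * r\<close>.\<close>

lemma unit_R:
  assumes x: "x \<in> R" "x / t \<notin> R"
  shows "inverse x \<in> R"
proof -
  obtain y where y: "y \<in> A" "(x - y) / t \<in> R"
    using dense[OF x(1), of 1] by auto
  have "x / t = (x - y) / t + y / t"
    by (simp add: field_simps)
  then have "y / t \<notin> A"
    using x(2) R.add_mem[OF y(2) mem_R, of "y / t"] by auto
  then have iy: "inverse y \<in> A" "y \<noteq> 0"
    using unit_A[OF y(1)] by auto
  define r where "r = - (inverse y * ((x - y) / t))"
  have "r \<in> R"
    unfolding r_def by (intro R.minus_mem R.mult_mem mem_R iy y)
  moreover have "x = y * (1 - t * r)"
    using iy by (simp add: r_def field_simps)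
  ultimately show ?thesis
    using R.mult_mem[OF inverse_one_minus mem_R[OF iy(1)], of r] by (simp add: mult.commute)
qed

text \<open>By the Hausdorff property only finitely many powers of \<open>t\<close> divide
  \<open>y\<close>; dividing by the last one leaves an element to which \<open>unit_R\<close>
  applies.\<close>

lemma unit_factor:
  assumes "y \<in> R" "y \<noteq> 0"
  obtains k where "y / t ^ k \<in> R" "y / t ^ Suc k \<notin> R" "inverse (y / t ^ k) \<in> R"
proof -
  have ex: "\<exists>k. y / t ^ k \<notin> R"
    using Hausdorff[of y] assms(2) by blast
  define m where "m = (LEAST k. y / t ^ k \<notin> R)"
  have m: "y / t ^ m \<notin> R"
    unfolding m_def by (rule LeastI_ex[OF ex])
  then obtain k where k: "m = Suc k"
    using assms(1) by (cases m) auto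
  have "y / t ^ k \<in> R"
    using not_less_Least[of k "\<lambda>k. y / t ^ k \<notin> R"] k by (auto simp: m_def)
  then show ?thesis
    using that[of k] unit_R[of "y / t ^ k"] m k by (simp add: field_simps)
qed

lemma clear_denominator: "\<exists>k. v * t ^ k \<in> R"
proof -
  obtain x y where v: "v = x / y" "x \<in> R" "y \<in> R" "y \<noteq> 0"
    using ambient unfolding fractions_def by blast
  obtain k where "inverse (y / t ^ k) \<in> R"
    using unit_factor[OF v(3,4)] by blast
  then have "x * inverse (y / t ^ k) \<in> R"
    using v(2) by (intro R.mult_mem)
  moreover have "x * inverse (y / t ^ k) = v * t ^ k"
    using v by simp
  ultimately show ?thesis by metis
qed

abbreviation K :: "'k set" where
  "K \<equiv> fractions A"

text \<open>A nonzero element of \<open>A\<close> is a power of \<open>t\<close> times a unit of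
  \<open>R\<close>, and \<open>restricted_power\<close> brings that unit back into \<open>A\<close>;
  so powers of \<open>t\<close> suffice as denominators.\<close>

lemma mem_K_iff: "x \<in> K \<longleftrightarrow> (\<exists>k. x * t ^ k \<in> A)"
proof
  assume "x \<in> K"
  then obtain p q where x: "x = p / q" "p \<in> A" "q \<in> A" "q \<noteq> 0"
    unfolding fractions_def by blast
  obtain k where k: "q / t ^ k \<in> R" "q / t ^ Suc k \<notin> R"
    using unit_factor[OF mem_R[OF x(3)] x(4)] by blast
  have "q / t ^ k \<in> A"
    using restricted_power[OF x(3) k(1)] .
  moreover have "q / t ^ k / t \<notin> A"
    using k(2) mem_R by (auto simp: field_simps)
  ultimately have "inverse (q / t ^ k) \<in> A"
    by (rule unit_A)
  then have "p * inverse (q / t ^ k) \<in> A"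
    using x(2) by (intro A.mult_mem)
  moreover have "p * inverse (q / t ^ k) = x * t ^ k"
    using x by simp
  ultimately show "\<exists>k. x * t ^ k \<in> A" by metis
next
  assume "\<exists>k. x * t ^ k \<in> A"
  then obtain k where "x * t ^ k \<in> A" ..
  moreover have "x = (x * t ^ k) / t ^ k" "t ^ k \<in> A" "t ^ k \<noteq> 0"
    using t_mem A.power_mem by auto
  ultimately show "x \<in> K"
    unfolding fractions_def by blast
qed

lemma div_power_mem_K: "x \<in> A \<Longrightarrow> x / t ^ k \<in> K"
  unfolding mem_K_iff by (rule exI[of _ k]) simp

lemma A_subset_K: "x \<in> A \<Longrightarrow> x \<in> K"
  using div_power_mem_K[of x 0] by simp

lemma common_denominator:
  assumes "x \<in> K" "y \<in> K"
  obtains k where "k > 0" "x * t ^ k \<in> A" "y * t ^ k \<in> A"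
proof -
  obtain i j where "x * t ^ i \<in> A" "y * t ^ j \<in> A"
    using assms mem_K_iff by blast
  \<comment> \<open>\<open>Suc\<close> keeps the exponent positive, as the condition
    \<open>m > 0\<close> in \<open>akizuki_res\<close> demands.\<close>
  then have "t ^ Suc j * (x * t ^ i) \<in> A" "t ^ Suc i * (y * t ^ j) \<in> A"
    using t_mem A.mult_power_mem by blast+
  then show ?thesis
    using that[of "Suc (i + j)"] by (simp add: power_add mult_ac)
qed

lemma field_subring_K: "field_subring K"
proof
  show "1 \<in> K"
    by (rule A_subset_K) (rule A.one_mem)
  fix x y assume "x \<in> K" "y \<in> K"
  then obtain k where k: "x * t ^ k \<in> A" "y * t ^ k \<in> A"
    using common_denominator by blast
  have "(x - y) * t ^ k \<in> A"
    using A.diff_mem[OF k] by (simp add: algebra_simps)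
  then show "x - y \<in> K"
    using mem_K_iff by blast
  have "(x * y) * t ^ (k + k) \<in> A"
    using A.mult_mem[OF k] by (simp add: power_add mult_ac)
  then show "x * y \<in> K"
    using mem_K_iff by blast
qed

sublocale K: field_subring K
  by (rule field_subring_K)

text \<open>This is the injectivity of the canonical map from \<open>K / A\<close> to its
  counterpart for the completion; \<open>K_dense\<close> is the surjectivity.\<close>

lemma K_Int_R: "x \<in> K \<Longrightarrow> x \<in> R \<Longrightarrow> x \<in> A"
proof -
  assume "x \<in> K" "x \<in> R"
  then obtain k where "x * t ^ k \<in> A"
    using mem_K_iff by blast
  then show "x \<in> A"
    using restricted_power[of "x * t ^ k" k] \<open>x \<in> R\<close> by simp
qed

lemma K_dense: "\<exists>x\<in>K. v - x \<in> R"
proof -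
  obtain k where "v * t ^ k \<in> R"
    using clear_denominator by blast
  then obtain y where y: "y \<in> A" "(v * t ^ k - y) / t ^ k \<in> R"
    using dense by blast
  then have "v - y / t ^ k \<in> R"
    by (simp add: field_simps)
  then show ?thesis
    using div_power_mem_K[OF y(1)] by blast
qed

subsection \<open>The quotient field modulo the ring\<close>

text \<open>The inverse of the canonical isomorphism, applied to the class of \<open>v\<close>.
  Residues can thus be computed with elements of the ambient field modulo \<open>R\<close>;
  \<open>frac_class_eqI\<close> frees the value from the choice of representative.\<close>

definition frac_class :: "'k \<Rightarrow> 'k set" where
  "frac_class v = A +>\<^bsub>embedded K\<^esub> (SOME x. x \<in> K \<and> v - x \<in> R)"

lemma frac_class_eqI:
  assumes "x \<in> K" "v - x \<in> R"
  shows "frac_class v = A +>\<^bsub>embedded K\<^esub> x"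
proof -
  define y where "y = (SOME x. x \<in> K \<and> v - x \<in> R)"
  have y: "y \<in> K \<and> v - y \<in> R"
    unfolding y_def by (rule someI[of _ x]) (use assms in simp)
  have "y - x = (v - x) - (v - y)"
    by simp
  moreover have "(v - x) - (v - y) \<in> R"
    using y assms by (intro R.diff_mem[of "v - x" "v - y"]) simp_all
  ultimately have "y - x \<in> R"
    by (simp only:)
  then have "y - x \<in> A"
    using y assms K_Int_R[OF K.diff_mem[of y x]] by simp
  then show ?thesis
    by (simp add: frac_class_def A.coset_eq_iff flip: y_def)
qed

lemma frac_class_eq_iff: "frac_class u = frac_class v \<longleftrightarrow> u - v \<in> R"
proof -
  obtain x y where x: "x \<in> K" "u - x \<in> R" and y: "y \<in> K" "v - y \<in> R"
    using K_dense by metis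
  have "(u - x) - (v - y) \<in> R"
    using x(2) y(2) by (rule R.diff_mem)
  then have "u - v \<in> R \<longleftrightarrow> x - y \<in> R"
    using R.add_mem[of "x - y" "(u - x) - (v - y)"] R.diff_mem[of "u - v" "(u - x) - (v - y)"]
    by auto
  also have "\<dots> \<longleftrightarrow> x - y \<in> A"
    using K_Int_R[OF K.diff_mem[OF x(1) y(1)]] mem_R by blast
  finally show ?thesis
    by (simp add: frac_class_eqI[OF x] frac_class_eqI[OF y] A.coset_eq_iff)
qed

lemma frac_class_eq_0_iff: "frac_class v = frac_class 0 \<longleftrightarrow> v \<in> R"
  by (simp add: frac_class_eq_iff)

lemma carrier_frac_quotient: "carrier (frac_quotient A) = range frac_class"
proof -
  have "carrier (frac_quotient A) = frac_class ` K"
    unfolding frac_quotient_def carrier_quotient_module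
    by (rule image_cong) (simp_all add: frac_class_eqI)
  moreover have "frac_class v \<in> frac_class ` K" for v
  proof -
    obtain x where "x \<in> K" "v - x \<in> R"
      using K_dense by blast
    then show ?thesis
      using frac_class_eq_iff[of v x] by (metis imageI)
  qed
  ultimately show ?thesis by auto
qed

lemma frac_class_mem: "frac_class v \<in> carrier (frac_quotient A)"
  by (simp add: carrier_frac_quotient)

lemma zero_frac_quotient: "\<zero>\<^bsub>frac_quotient A\<^esub> = frac_class 0"
  by (simp add: frac_class_eqI[of 0] A.coset_zero frac_quotient_def quotient_module_def)

lemma frac_class_add:
  "frac_class u \<oplus>\<^bsub>frac_quotient A\<^esub> frac_class v = frac_class (u + v)"
proof -
  obtain x y where x: "x \<in> K" "u - x \<in> R" and y: "y \<in> K" "v - y \<in> R"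
    using K_dense by metis
  have "u + v - (x + y) \<in> R"
    using R.add_mem[OF x(2) y(2)] by (simp add: algebra_simps)
  then show ?thesis
    using frac_class_eqI[OF x] frac_class_eqI[OF y] frac_class_eqI[OF K.add_mem[OF x(1) y(1)]]
    by (simp add: frac_quotient_def A.quotient_add)
qed

lemma frac_class_smult:
  assumes c: "c \<in> A"
  shows "c \<odot>\<^bsub>frac_quotient A\<^esub> frac_class v = frac_class (c * v)"
proof -
  obtain x where x: "x \<in> K" "v - x \<in> R"
    using K_dense by metis
  have "c * v - c * x \<in> R"
    using R.mult_mem[OF mem_R[OF c] x(2)] by (simp add: algebra_simps)
  then show ?thesis
    using frac_class_eqI[OF x] frac_class_eqI[OF K.mult_mem[OF A_subset_K[OF c] x(1)]]
    by (simp add: frac_quotient_def A.quotient_smult[OF c])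
qed

lemma genfrac_A_eq: "genfrac_A A R t f m = frac_class (f / t ^ m)"
  unfolding genfrac_A_def
proof (rule the_inv_into_f_eq)
  have map: "frac_quotient_map R (A +>\<^bsub>embedded K\<^esub> x) = R +>\<^bsub>embedded (fractions R)\<^esub> x" for x
    unfolding frac_quotient_map_def by (intro R.coset_add A_subset A.zero_mem)
  have map_class: "frac_quotient_map R (frac_class v) = R +>\<^bsub>embedded (fractions R)\<^esub> v" for v
  proof -
    obtain x where x: "x \<in> K" "v - x \<in> R"
      using K_dense by metis
    then have "R +>\<^bsub>embedded (fractions R)\<^esub> v = R +>\<^bsub>embedded (fractions R)\<^esub> x"
      by (simp add: R.coset_eq_iff)
    then show ?thesis
      by (simp add: frac_class_eqI[OF x] map)
  qed
  show "inj_on (frac_quotient_map R) (carrier (frac_quotient A))"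
    by (rule inj_onI)
      (auto simp: carrier_frac_quotient map_class R.coset_eq_iff simp flip: frac_class_eq_iff)
  show "frac_quotient_map R (frac_class (f / t ^ m)) = R +>\<^bsub>embedded (fractions R)\<^esub> (f / t ^ m)"
    by (rule map_class)
qed (rule frac_class_mem)

end

section \<open>Polynomials over a subring\<close>

text \<open>Polynomials over the whole field with confined coefficients: composition and the degree
  formulas for integral domains apply to them directly.\<close>

definition polys_over :: "'k::field set \<Rightarrow> 'k poly set" where
  "polys_over S = {p. \<forall>i. poly.coeff p i \<in> S}"

context field_subring
begin

lemma polys_overI: "(\<And>i. poly.coeff p i \<in> S) \<Longrightarrow> p \<in> polys_over S"
  by (simp add: polys_over_def)

lemma coeff_polys_over: "p \<in> polys_over S \<Longrightarrow> poly.coeff p i \<in> S"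
  by (simp add: polys_over_def)

lemma polys_over_add: "p \<in> polys_over S \<Longrightarrow> q \<in> polys_over S \<Longrightarrow> p + q \<in> polys_over S"
  by (simp add: polys_over_def add_mem)

lemma polys_over_diff: "p \<in> polys_over S \<Longrightarrow> q \<in> polys_over S \<Longrightarrow> p - q \<in> polys_over S"
  by (simp add: polys_over_def diff_mem)

lemma polys_over_smult: "c \<in> S \<Longrightarrow> p \<in> polys_over S \<Longrightarrow> Polynomial.smult c p \<in> polys_over S"
  by (simp add: polys_over_def mult_mem)

lemma polys_over_mult: "p \<in> polys_over S \<Longrightarrow> q \<in> polys_over S \<Longrightarrow> p * q \<in> polys_over S"
  unfolding polys_over_def
  using coeff_mult_semiring_closed[of S p q] zero_mem add_mem mult_mem by simp

lemma polys_over_pcompose: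
  "p \<in> polys_over S \<Longrightarrow> q \<in> polys_over S \<Longrightarrow> pcompose p q \<in> polys_over S"
  unfolding polys_over_def
  using coeff_pcompose_semiring_closed[of S p q] zero_mem add_mem mult_mem by simp

lemma polys_over_pCons: "c \<in> S \<Longrightarrow> p \<in> polys_over S \<Longrightarrow> pCons c p \<in> polys_over S"
  by (auto simp: polys_over_def coeff_pCons split: nat.split)

lemma polys_over_0: "0 \<in> polys_over S"
  by (simp add: polys_over_def)

lemma polys_over_1: "1 \<in> polys_over S"
  unfolding one_pCons by (intro polys_over_pCons polys_over_0 one_mem)

lemma poly_mem:
  assumes "p \<in> polys_over T" "T \<subseteq> S" "x \<in> S"
  shows "poly p x \<in> S"
  unfolding poly_altdef
proof (rule sum_mem)
  fix i
  have "poly.coeff p i \<in> S"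
    using assms by (auto simp: polys_over_def)
  then show "poly.coeff p i * x ^ i \<in> S"
    using assms(3) by (intro mult_mem power_mem)
qed

end

text \<open>For nonzero \<open>Q\<close> the two summands would have the same degree, even for the
  first and odd for the second.\<close>

lemma even_plus_odd_eq_0:
  fixes P Q :: "'k::field poly"
  assumes "pcompose P [:0, 0, 1:] + [:0, 1:] * pcompose Q [:0, 0, 1:] = 0"
  shows "Q = 0"
proof (rule ccontr)
  assume "Q \<noteq> 0"
  then have nz: "pcompose Q [:0, 0, 1:] \<noteq> 0"
    by (simp add: pcompose_eq_0_iff)
  have "pcompose P [:0, 0, 1:] = - ([:0, 1:] * pcompose Q [:0, 0, 1:])"
    using assms by (simp only: eq_neg_iff_add_eq_0)
  then have "Polynomial.degree (pcompose P [:0, 0, 1:])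
      = Polynomial.degree ([:0, 1:] * pcompose Q [:0, 0, 1:])"
    by (simp only: degree_minus)
  also have "\<dots> = Suc (Polynomial.degree Q * 2)"
    using nz by (subst degree_mult_eq) (simp_all add: degree_pcompose)
  finally have "Polynomial.degree P * 2 = Suc (Polynomial.degree Q * 2)"
    by (simp add: degree_pcompose)
  then show False
    by presburger
qed


section \<open>Akizuki's ring\<close>

locale akizuki = complete_dvr A R t for A R :: "'k::field set" and t +
  fixes a :: "nat \<Rightarrow> 'k" and n :: "nat \<Rightarrow> nat" and z :: 'k
  assumes a_mem: "a i \<in> A"
    and expansion: "adic_sums R t (\<lambda>i. a i * t ^ n i) z"
    and transcendental: "p \<in> polys_over A \<Longrightarrow> poly p z = 0 \<Longrightarrow> p = 0"
    and n_0: "n 0 = 0"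
    and n_Suc: "n (Suc r) \<ge> 2 * n r + 2"
begin

subsection \<open>Tails of the expansion\<close>

definition partial :: "nat \<Rightarrow> 'k" where
  "partial r = (\<Sum>i<r. a i * t ^ n i)"

abbreviation tail :: "nat \<Rightarrow> 'k" where
  "tail r \<equiv> tail_sum R t a n r"

lemma partial_Suc: "partial (Suc r) = partial r + a r * t ^ n r"
  by (simp add: partial_def)

lemma partial_mem: "partial r \<in> A"
  unfolding partial_def using a_mem t_mem by (intro A.sum_mem A.mult_mem A.power_mem)

lemma n_mono: "i \<le> j \<Longrightarrow> n i \<le> n j"
proof (induction j rule: dec_induct)
  case (step j)
  then show ?case using n_Suc[of j] by linarith
qed simp

text \<open>Late partial sums agree with \<open>z\<close> modulo \<open>t ^ n r\<close>, and they
  agree with \<open>partial r\<close> because all later exponents are at least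
  \<open>n r\<close>.\<close>

lemma tail_mem_aux: "(z - partial r) / t ^ n r \<in> R"
proof -
  obtain N where N: "\<And>i. i \<ge> N \<Longrightarrow> (partial i - z) / t ^ n r \<in> R"
    using expansion unfolding adic_sums_def adic_lim_def mem_adic_nbhd_iff[OF t_nonzero]
    unfolding partial_def by blast
  have "(partial i - partial r) / t ^ n r \<in> R" if "r \<le> i" for i
    using that
  proof (induction i rule: dec_induct)
    case (step i)
    have "(partial (Suc i) - partial r) / t ^ n r
        = (partial i - partial r) / t ^ n r + a i * (t ^ n i / t ^ n r)"
      by (simp add: partial_Suc field_simps)
    moreover have "t ^ n i / t ^ n r = t ^ (n i - n r)"
      using n_mono[OF step.hyps(1)] by (simp add: power_diff)
    ultimately show ?case
      using step.IH a_mem mem_R R.add_mem R.mult_mem R.power_mem[OF t_mem_R] by simp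
  qed simp
  then have "(partial (max N r) - partial r) / t ^ n r - (partial (max N r) - z) / t ^ n r \<in> R"
    using N by (intro R.diff_mem) simp_all
  then show ?thesis
    by (simp flip: diff_divide_distrib)
qed

lemma adic_lim_unique:
  assumes "adic_lim R t u l" "adic_lim R t u l'"
  shows "l = l'"
proof -
  have "l - l' = 0"
  proof (rule Hausdorff)
    fix k
    obtain N N' where "\<And>i. i \<ge> N \<Longrightarrow> (u i - l) / t ^ k \<in> R" "\<And>i. i \<ge> N' \<Longrightarrow> (u i - l') / t ^ k \<in> R"
      using assms unfolding adic_lim_def mem_adic_nbhd_iff[OF t_nonzero] by metis
    then have "(u (max N N') - l') / t ^ k - (u (max N N') - l) / t ^ k \<in> R"
      by (intro R.diff_mem) simp_all
    then show "(l - l') / t ^ k \<in> R"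
      by (simp flip: diff_divide_distrib)
  qed
  then show ?thesis by simp
qed

text \<open>From here on the tails are handled by field arithmetic instead of limits.\<close>

lemma tail_eq: "tail r = (z - partial r) / t ^ n r"
proof -
  have sum: "(\<Sum>i<m. a (r + i) * t ^ (n (r + i) - n r)) = (partial (r + m) - partial r) / t ^ n r" for m
  proof (induction m)
    case (Suc m)
    have "t ^ (n (r + m) - n r) = t ^ n (r + m) / t ^ n r"
      using n_mono[of r "r + m"] by (simp add: power_diff)
    then show ?case
      by (simp only: sum.lessThan_Suc Suc.IH partial_Suc add_Suc_right) (simp add: field_simps)
  qed simp
  have "adic_sums R t (\<lambda>i. a (r + i) * t ^ (n (r + i) - n r)) ((z - partial r) / t ^ n r)"
    unfolding adic_sums_def adic_lim_def sum mem_adic_nbhd_iff[OF t_nonzero]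
  proof (intro conjI allI tail_mem_aux)
    fix k
    \<comment> \<open>The extra \<open>n r\<close> in the precision pays for the division by
      \<open>t ^ n r\<close>.\<close>
    obtain N where N: "\<And>i. i \<ge> N \<Longrightarrow> (partial i - z) / t ^ (n r + k) \<in> R"
      using expansion unfolding adic_sums_def adic_lim_def mem_adic_nbhd_iff[OF t_nonzero]
      unfolding partial_def by blast
    have "((partial (r + i) - partial r) / t ^ n r - (z - partial r) / t ^ n r) / t ^ k \<in> R"
      if "i \<ge> N" for i
    proof -
      have "((partial (r + i) - partial r) / t ^ n r - (z - partial r) / t ^ n r) / t ^ k
          = (partial (r + i) - z) / t ^ (n r + k)"
        by (simp add: power_add flip: diff_divide_distrib)
      then show ?thesis
        using N[of "r + i"] that by simp
    qed
    then show "\<exists>N. \<forall>i\<ge>N.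
        ((partial (r + i) - partial r) / t ^ n r - (z - partial r) / t ^ n r) / t ^ k \<in> R"
      by blast
  qed
  then show ?thesis
    unfolding tail_sum_def adic_sums_def by (intro the_equality) (auto intro: adic_lim_unique)
qed

lemma tail_mem: "tail r \<in> R"
  unfolding tail_eq by (rule tail_mem_aux)

lemma tail_minus: "t ^ n r * (tail r - a r) = z - partial (Suc r)"
  by (simp add: tail_eq partial_Suc field_simps)

lemma tail_Suc: "tail r - a r = t ^ (n (Suc r) - n r) * tail (Suc r)"
proof -
  have "t ^ n (Suc r) = t ^ n r * t ^ (n (Suc r) - n r)"
    using n_mono[of r "Suc r"] by (simp flip: power_add)
  then have "t ^ n r * (tail r - a r) = t ^ n r * (t ^ (n (Suc r) - n r) * tail (Suc r))"
    unfolding tail_minus tail_eq[of "Suc r"] by simp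
  then show ?thesis by simp
qed

abbreviation w :: 'k where
  "w \<equiv> akizuki_w R t a n"

definition u :: "nat \<Rightarrow> 'k" where
  "u i = (tail i - a i) ^ 2"

lemma u_mem_R: "u i \<in> R"
  unfolding u_def by (intro R.power_mem R.diff_mem tail_mem mem_R a_mem)

lemma w_eq: "w = t * (z - a 0)"
  by (simp add: akizuki_w_def tail_eq n_0 partial_def)

lemma w_div_t_mem: "w / t \<in> R"
  using R.diff_mem[OF tail_mem mem_R[OF a_mem]] by (simp add: akizuki_w_def)

lemma w_mem_R: "w \<in> R"
  using R.mult_mem[OF t_mem_R w_div_t_mem] by simp

lemma w_square: "w * w = t ^ 2 * u 0"
  by (simp add: akizuki_w_def u_def power2_eq_square)

text \<open>The growth of the exponents enters here: it makes the coefficients divisible by \<open>t\<close>.\<close>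

lemma u_step: "\<exists>p\<in>A. \<exists>q\<in>A. \<exists>r\<in>A. u i = t * (p + q * w + r * u (Suc i))"
proof -
  define m where "m = n (Suc i) - n i"
  \<comment> \<open>The growth condition gives \<open>2 * m\<close> at least
    \<open>n (Suc i) + 2\<close> factors \<open>t\<close>: \<open>n (Suc i) + 1\<close> of them turn
    the tail \<open>s\<close> into \<open>w + t * \<alpha>\<close>, one stays in front, and
    \<open>e\<close> counts the rest.\<close>
  define e where "e = 2 * m - (n (Suc i) + 2)"
  define b where "b = a (Suc i)"
  define s where "s = tail (Suc i)"
  define \<alpha> where "\<alpha> = a 0 - partial (Suc i)"
  have "2 * m \<ge> n (Suc i) + 2"
    using n_Suc[of i] by (simp add: m_def)
  then have "2 * m = e + 1 + Suc (n (Suc i))" and m: "2 * m = Suc (2 * m - 1)"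
    by (simp_all add: e_def)
  then have pow: "t ^ (2 * m) = t ^ e * t * t ^ Suc (n (Suc i))"
    by (simp only: power_add power_one_right)
  have s: "t ^ Suc (n (Suc i)) * s = w + t * \<alpha>"
    by (simp add: s_def w_eq \<alpha>_def tail_eq field_simps)
  have "u i = t ^ (2 * m) * s ^ 2"
    by (simp add: u_def tail_Suc s_def m_def power_mult_distrib mult.commute flip: power_mult)
  \<comment> \<open>Expanding around \<open>b\<close> leaves a term linear in \<open>s\<close>,
    which the reserved powers of \<open>t\<close> convert into \<open>w\<close>.\<close>
  also have "s ^ 2 = u (Suc i) - b ^ 2 + 2 * b * s"
    by (simp add: u_def b_def s_def power2_eq_square algebra_simps)
  also have "t ^ (2 * m) * (u (Suc i) - b ^ 2 + 2 * b * s)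
      = t ^ (2 * m) * (u (Suc i) - b ^ 2) + t ^ e * t * (2 * b) * (t ^ Suc (n (Suc i)) * s)"
    unfolding distrib_left by (subst (2) pow) (simp only: mult_ac)
  also have "\<dots> = t * t ^ (2 * m - 1) * (u (Suc i) - b ^ 2) + t ^ e * t * (2 * b) * (w + t * \<alpha>)"
    unfolding s by (subst m) simp
  also have "\<dots> = t * ((t ^ e * (2 * b) * (t * \<alpha>) - t ^ (2 * m - 1) * b ^ 2)
      + (t ^ e * (2 * b)) * w + t ^ (2 * m - 1) * u (Suc i))"
    by (simp add: algebra_simps)
  finally have eq: "u i = t * ((t ^ e * (2 * b) * (t * \<alpha>) - t ^ (2 * m - 1) * b ^ 2)
      + (t ^ e * (2 * b)) * w + t ^ (2 * m - 1) * u (Suc i))" .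
  have b: "b \<in> A" "\<alpha> \<in> A"
    unfolding b_def \<alpha>_def by (intro A.diff_mem a_mem partial_mem)+
  show ?thesis
    by (intro bexI, rule eq) (intro A.diff_mem A.mult_mem A.power_mem t_mem A.two_mem b)+
qed


subsection \<open>The ring and its maximal ideal\<close>

abbreviation C :: "'k set" where
  "C \<equiv> akizuki_C A R t a n"

lemma gens_subset: "A \<union> {w} \<union> range (\<lambda>i. (tail i - a i) ^ 2) \<subseteq> R"
  using A_subset w_mem_R u_mem_R by (auto simp: u_def)

sublocale C: field_subring C
  unfolding akizuki_C_def by (rule R.field_subring_generate_ring[OF gens_subset])

lemma A_subset_C: "x \<in> A \<Longrightarrow> x \<in> C"
  and w_mem_C: "w \<in> C"
  and u_mem_C: "u i \<in> C"
  unfolding akizuki_C_def u_def by (rule generate_ring.incl, simp)+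

lemma C_least:
  assumes "field_subring T" "T \<subseteq> R" "\<And>x. x \<in> A \<Longrightarrow> x \<in> T" "w \<in> T" "\<And>i. u i \<in> T"
  shows "C \<subseteq> T"
  unfolding akizuki_C_def using assms by (intro R.generate_ring_least) (auto simp: u_def)

lemma C_subset_R: "C \<subseteq> R"
  using R.field_subring_axioms mem_R w_mem_R u_mem_R by (intro C_least) auto

lemma mem_R_if_mem_C: "x \<in> C \<Longrightarrow> x \<in> R"
  using C_subset_R by blast

lemma t_mem_C: "t \<in> C"
  using t_mem by (rule A_subset_C)

text \<open>The right side is a subring containing the generators: \<open>w * w\<close> is
  \<open>t ^ 2 * u 0\<close>, and by \<open>u_step\<close> every \<open>u i\<close> is
  \<open>t\<close> times an element of \<open>C\<close>.\<close>

lemma C_decomp_aux: "C \<subseteq> {x + y * w + t * d | x y d. x \<in> A \<and> y \<in> A \<and> d \<in> C}" (is "_ \<subseteq> ?T")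
proof (rule C_least)
  have memI: "c \<in> ?T" if "c = x + y * w + t * d" "x \<in> A" "y \<in> A" "d \<in> C" for c x y d
    using that by blast
  show "?T \<subseteq> R"
  proof safe
    fix x y d assume "x \<in> A" "y \<in> A" "d \<in> C"
    then show "x + y * w + t * d \<in> R"
      by (intro R.add_mem R.mult_mem w_mem_R t_mem_R) (simp_all add: mem_R mem_R_if_mem_C)
  qed
  show "x \<in> ?T" if "x \<in> A" for x
    by (rule memI[of _ x 0 0]) (simp_all add: that)
  show "w \<in> ?T"
    by (rule memI[of _ 0 1 0]) simp_all
  show "u i \<in> ?T" for i
  proof -
    obtain p q r where pqr: "p \<in> A" "q \<in> A" "r \<in> A" "u i = t * (p + q * w + r * u (Suc i))"
      using u_step by blast
    then have "p + q * w + r * u (Suc i) \<in> C"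
      by (intro C.add_mem C.mult_mem A_subset_C w_mem_C u_mem_C)
    then show ?thesis
      using pqr(4) by (intro memI[of _ 0 0]) simp_all
  qed
  show "field_subring ?T"
  proof
    show "1 \<in> ?T"
      by (rule memI[of _ 1 0 0]) simp_all
    fix c c' assume "c \<in> ?T" "c' \<in> ?T"
    then obtain x y d x' y' d' where c: "c = x + y * w + t * d" "x \<in> A" "y \<in> A" "d \<in> C"
      and c': "c' = x' + y' * w + t * d'" "x' \<in> A" "y' \<in> A" "d' \<in> C"
      by blast
    show "c - c' \<in> ?T"
      by (rule memI[of _ "x - x'" "y - y'" "d - d'"])
        (use c(2-) c'(2-) in \<open>simp_all add: c(1) c'(1) algebra_simps A.diff_mem C.diff_mem\<close>)
    show "c * c' \<in> ?T"
    \<comment> \<open>The summand \<open>t * (y * y' * u 0)\<close> is what remains of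
      \<open>y * y' * (w * w)\<close> after one \<open>t\<close> is taken out.\<close>
    proof (rule memI[of _ "x * x'" "x * y' + y * x'"
          "t * (y * y' * u 0) + (x + y * w) * d' + d * (x' + y' * w + t * d')"])
      have "c * c' = x * x' + (x * y' + y * x') * w + y * y' * (w * w)
          + t * ((x + y * w) * d' + d * (x' + y' * w + t * d'))"
        by (simp add: c(1) c'(1) algebra_simps)
      then show "c * c' = x * x' + (x * y' + y * x') * w
          + t * (t * (y * y' * u 0) + (x + y * w) * d' + d * (x' + y' * w + t * d'))"
        unfolding w_square by (simp add: power2_eq_square algebra_simps)
    qed (simp_all add: c(2-) c'(2-) A.add_mem A.mult_mem C.add_mem C.mult_mem w_mem_C u_mem_C t_mem_C
        A_subset_C)
  qed
qed

lemma C_decomp: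
  assumes "c \<in> C"
  obtains x y d where "x \<in> A" "y \<in> A" "d \<in> C" "c = x + y * w + t * d"
  using assms C_decomp_aux by blast

abbreviation M :: "'k set" where
  "M \<equiv> akizuki_M A R t a n"

lemma ideal_M: "ideal M (embedded C)"
proof -
  interpret CR: cring "embedded C" by (rule C.cring_embedded)
  show ?thesis
    unfolding akizuki_M_def using t_mem_C w_mem_C by (intro CR.genideal_ideal) simp
qed

lemma M_subset_C: "x \<in> M \<Longrightarrow> x \<in> C"
  using ideal.Icarr[OF ideal_M] by simp

lemma M_add: "x \<in> M \<Longrightarrow> y \<in> M \<Longrightarrow> x + y \<in> M"
  using additive_subgroup.a_closed[OF ideal.axioms(1)[OF ideal_M], of x y] by simp

lemma M_mult: "c \<in> C \<Longrightarrow> x \<in> M \<Longrightarrow> c * x \<in> M"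
  using ideal.I_l_closed[OF ideal_M, of x c] by simp

lemma t_mem_M: "t \<in> M" and w_mem_M: "w \<in> M"
  unfolding akizuki_M_def genideal_def by auto

lemma M_decomp_aux:
  assumes "c \<in> C" "c / t \<in> R"
  obtains p q where "p \<in> C" "q \<in> C" "c = t * p + q * w"
proof -
  obtain x y d where d: "x \<in> A" "y \<in> A" "d \<in> C" "c = x + y * w + t * d"
    using C_decomp[OF assms(1)] .
  have "x / t = c / t - y * (w / t) - d"
    using d(4) by (simp add: field_simps)
  also have "\<dots> \<in> R"
    using assms(2) d(2,3) mem_R mem_R_if_mem_C R.diff_mem R.mult_mem w_div_t_mem by metis
  finally have "x / t \<in> C"
    using restricted[OF d(1)] A_subset_C by simp
  moreover have "c = t * (x / t + d) + y * w"
    using d(4) by (simp add: field_simps)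
  ultimately show ?thesis
    using d(3) A_subset_C[OF d(2)] by (intro that[of "x / t + d" y] C.add_mem)
qed

text \<open>\<open>M\<close> is the contraction of the maximal ideal of \<open>R\<close>: in
  \<open>x + y * w + t * d\<close> the last two terms are divisible by \<open>t\<close> in
  \<open>R\<close>, so divisibility rests on \<open>x\<close>, where it descends to
  \<open>A\<close>.\<close>

lemma mem_M_iff: "c \<in> M \<longleftrightarrow> c \<in> C \<and> c / t \<in> R"
proof
  have "ideal {c \<in> C. c / t \<in> R} (embedded C)"
  proof (rule C.ideal_embedded)
    show "x + y \<in> {c \<in> C. c / t \<in> R}" if "x \<in> {c \<in> C. c / t \<in> R}" "y \<in> {c \<in> C. c / t \<in> R}" for x y
      using that C.add_mem[of x y] R.add_mem[of "x / t" "y / t"] by (simp add: add_divide_distrib)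
    show "c * x \<in> {c \<in> C. c / t \<in> R}" if "c \<in> C" "x \<in> {c \<in> C. c / t \<in> R}" for c x
      using that C.mult_mem[of c x] R.mult_mem[of c "x / t"] mem_R_if_mem_C[of c] by simp
  qed auto
  moreover have "{t, w} \<subseteq> {c \<in> C. c / t \<in> R}"
    using t_mem_C w_mem_C w_div_t_mem by simp
  ultimately have "M \<subseteq> {c \<in> C. c / t \<in> R}"
    unfolding akizuki_M_def genideal_def by blast
  then show "c \<in> C \<and> c / t \<in> R" if "c \<in> M"
    using that by blast
next
  assume "c \<in> C \<and> c / t \<in> R"
  then obtain p q where "p \<in> C" "q \<in> C" "c = t * p + q * w"
    using M_decomp_aux by blast
  then show "c \<in> M"
    using M_add[OF M_mult[OF _ t_mem_M] M_mult[OF _ w_mem_M], of p q] by (simp add: mult.commute)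
qed

lemma M_decomp:
  assumes "c \<in> M"
  obtains p q where "p \<in> C" "q \<in> C" "c = t * p + q * w"
  using assms M_decomp_aux mem_M_iff by blast

text \<open>Products of generators that involve \<open>t\<close> are clear, and
  \<open>w * w / t\<close> is \<open>t * u 0\<close>. The inversion in \<open>CM_decomp_C\<close>
  and the comparison of the \<open>M\<close>-adic with the \<open>t\<close>-adic topology rest on
  this.\<close>

lemma M_square:
  assumes "c \<in> M" "c' \<in> M"
  shows "c * c' / t \<in> M"
proof -
  obtain p q where c: "p \<in> C" "q \<in> C" "c = t * p + q * w"
    using M_decomp[OF assms(1)] .
  obtain p' q' where c': "p' \<in> C" "q' \<in> C" "c' = t * p' + q' * w"
    using M_decomp[OF assms(2)] .
  have "c * c' = t * (p * c' + (q * p') * w) + q * q' * (w * w)"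
    using c(3) c'(3) by (simp add: algebra_simps)
  then have "c * c' / t = p * c' + (q * p') * w + (q * q' * u 0) * t"
    unfolding w_square by (simp add: field_simps power2_eq_square)
  also have "\<dots> \<in> M"
    using c c' assms(2) by (intro M_add M_mult C.mult_mem t_mem_M w_mem_M u_mem_C)
  finally show ?thesis .
qed


subsection \<open>Independence of \<open>1\<close> and \<open>w\<close> modulo \<open>t\<close>\<close>

text \<open>The element is \<open>z - partial (Suc N)\<close> divided by \<open>t ^ n N\<close>, so
  a relation for it becomes one for \<open>z\<close> once denominators are cleared.\<close>

lemma transcendental_tail:
  assumes p: "p \<in> polys_over A" "poly p (tail N - a N) = 0"
  shows "p = 0"
proof -
  define s where "s = tail N - a N"
  define d where "d = Polynomial.degree p"
  define e where "e = n N"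
  \<comment> \<open>The weights make \<open>q\<close> at \<open>t ^ e * s\<close> equal to
    \<open>t ^ (e * d)\<close> times \<open>p\<close> at \<open>s\<close> and keep the coefficients
    in \<open>A\<close>; \<open>r\<close> takes care of the translation.\<close>
  define q where "q = (\<Sum>i\<le>d. Polynomial.monom (poly.coeff p i * t ^ (e * (d - i))) i)"
  define r where "r = pcompose q [:- partial (Suc N), 1:]"
  have coeff_q: "poly.coeff q i = poly.coeff p i * t ^ (e * (d - i))" for i
    unfolding q_def coeff_sum by (auto simp: d_def coeff_eq_0)
  have zs: "z - partial (Suc N) = t ^ e * s"
    unfolding e_def s_def by (rule tail_minus[symmetric])
  have "poly r z = poly q (t ^ e * s)"
    by (simp add: r_def poly_pcompose zs[symmetric])
  also have "\<dots> = (\<Sum>i\<le>d. poly.coeff p i * t ^ (e * (d - i)) * (t ^ e * s) ^ i)"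
    by (simp add: q_def poly_sum poly_monom)
  also have "\<dots> = (\<Sum>i\<le>d. t ^ (e * d) * (poly.coeff p i * s ^ i))"
  proof (rule sum.cong)
    fix i assume "i \<in> {..d}"
    then have "t ^ (e * d) = t ^ (e * (d - i)) * (t ^ e) ^ i"
      by (simp add: diff_mult_distrib2 flip: power_mult power_add)
    then show "poly.coeff p i * t ^ (e * (d - i)) * (t ^ e * s) ^ i = t ^ (e * d) * (poly.coeff p i * s ^ i)"
      by (simp add: power_mult_distrib)
  qed simp
  also have "\<dots> = t ^ (e * d) * poly p s"
    by (simp add: poly_altdef d_def sum_distrib_left)
  finally have "poly r z = 0"
    using p(2) by (simp add: s_def)
  moreover have "r \<in> polys_over A"
    unfolding r_def
  proof (rule A.polys_over_pcompose)
    show "q \<in> polys_over A"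
      using p(1) t_mem by (intro A.polys_overI) (simp add: coeff_q A.mult_mem A.power_mem A.coeff_polys_over)
    show "[:- partial (Suc N), 1:] \<in> polys_over A"
      by (intro A.polys_over_pCons A.polys_over_0 A.minus_mem partial_mem A.one_mem)
  qed
  ultimately have "r = 0"
    using transcendental by blast
  then have "q = 0"
    by (simp add: r_def pcompose_eq_0_iff)
  then have "poly.coeff p i = 0" for i
    using coeff_q[of i] by simp
  then show ?thesis
    by (intro poly_eqI) simp
qed

lemma tail_odd_part_eq_0:
  assumes P: "P \<in> polys_over A" and Q: "Q \<in> polys_over A"
    and "poly P ((tail N - a N) ^ 2) + (tail N - a N) * poly Q ((tail N - a N) ^ 2) = 0"
  shows "Q = 0"
proof -
  have "[:0, 0, 1:] \<in> polys_over A" "[:0, 1:] \<in> polys_over A"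
    by (intro A.polys_over_pCons A.polys_over_0 A.zero_mem A.one_mem)+
  then have "pcompose P [:0, 0, 1:] + [:0, 1:] * pcompose Q [:0, 0, 1:] \<in> polys_over A"
    by (intro A.polys_over_add A.polys_over_mult A.polys_over_pcompose P Q)
  then have "pcompose P [:0, 0, 1:] + [:0, 1:] * pcompose Q [:0, 0, 1:] = 0"
    by (rule transcendental_tail[of _ N]) (use assms(3) in \<open>simp add: poly_pcompose power2_eq_square\<close>)
  then show ?thesis
    by (rule even_plus_odd_eq_0)
qed

text \<open>\<open>approx N\<close> is the ring \<open>A[w, u\<^sub>N]\<close>, which contains \<open>u\<^sub>0, \<dots>, u\<^sub>N\<close>; with
  \<open>s = tail N - a\<^sub>N\<close> it is \<open>A[s\<^sup>2, t\<^bsup>n\<^sub>N+1\<^esup>s]\<close>.\<close>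

definition approx :: "nat \<Rightarrow> 'k set" where
  "approx N = {poly P (u N) + t ^ Suc (n N) * (tail N - a N) * poly Q (u N) | P Q.
     P \<in> polys_over A \<and> Q \<in> polys_over A}"

lemma approxI:
  "c = poly P (u N) + t ^ Suc (n N) * (tail N - a N) * poly Q (u N) \<Longrightarrow>
    P \<in> polys_over A \<Longrightarrow> Q \<in> polys_over A \<Longrightarrow> c \<in> approx N"
  unfolding approx_def by blast

lemma approxE:
  assumes "c \<in> approx N"
  obtains P Q where "P \<in> polys_over A" "Q \<in> polys_over A"
    "c = poly P (u N) + t ^ Suc (n N) * (tail N - a N) * poly Q (u N)"
  using assms unfolding approx_def by blast

lemma A_subset_approx: "x \<in> A \<Longrightarrow> x \<in> approx N"
  by (rule approxI[of _ "[:x:]" _ 0]) (simp_all add: A.polys_over_pCons A.polys_over_0)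

lemma field_subring_approx: "field_subring (approx N)"
proof
  define s where "s = tail N - a N"
  define k where "k = Suc (n N)"
  have u: "u N = s * s"
    by (simp add: u_def s_def power2_eq_square)
  show "1 \<in> approx N"
    by (rule A_subset_approx) simp
  fix c c' assume "c \<in> approx N" "c' \<in> approx N"
  then obtain P Q P' Q' where P: "P \<in> polys_over A" "Q \<in> polys_over A" "P' \<in> polys_over A" "Q' \<in> polys_over A"
    and c: "c = poly P (u N) + t ^ k * s * poly Q (u N)" "c' = poly P' (u N) + t ^ k * s * poly Q' (u N)"
    unfolding k_def s_def by (elim approxE) blast
  show "c - c' \<in> approx N"
    by (rule approxI[of _ "P - P'" _ "Q - Q'"])
      (use P in \<open>simp_all add: c A.polys_over_diff algebra_simps flip: k_def s_def\<close>)
  show "c * c' \<in> approx N"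
  \<comment> \<open>Odd times odd yields the factor \<open>s * s\<close>, that is
    \<open>u N\<close>, which \<open>pCons 0\<close> supplies to the even part.\<close>
  proof (rule approxI[of _ "P * P' + Polynomial.smult (t ^ k * t ^ k) (pCons 0 (Q * Q'))" _ "P * Q' + Q * P'"])
    show "c * c' = poly (P * P' + Polynomial.smult (t ^ k * t ^ k) (pCons 0 (Q * Q'))) (u N)
        + t ^ Suc (n N) * (tail N - a N) * poly (P * Q' + Q * P') (u N)"
      unfolding k_def[symmetric] s_def[symmetric] c by (simp add: u algebra_simps)
  qed (use P t_mem in \<open>simp_all add: A.polys_over_add A.polys_over_mult A.polys_over_smult
      A.polys_over_pCons A.mult_mem A.power_mem\<close>)
qed

lemma approx_subset_R: "approx N \<subseteq> R"
proof
  fix c assume "c \<in> approx N"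
  then obtain P Q where P: "P \<in> polys_over A" "Q \<in> polys_over A"
    and c: "c = poly P (u N) + t ^ Suc (n N) * (tail N - a N) * poly Q (u N)"
    by (rule approxE)
  show "c \<in> R"
    unfolding c using P
    by (intro R.add_mem R.mult_mem R.power_mem R.diff_mem tail_mem mem_R[OF a_mem] t_mem_R
        R.poly_mem[OF _ A_subset] u_mem_R)
qed

lemma w_tail: "w = t * (partial (Suc N) - a 0) + t ^ Suc (n N) * (tail N - a N)"
proof -
  have "t ^ Suc (n N) * (tail N - a N) = t * (z - partial (Suc N))"
    using tail_minus[of N] by (simp only: power_Suc mult.assoc)
  then show ?thesis
    by (simp only: w_eq) (simp add: algebra_simps)
qed

lemma w_mem_approx: "w \<in> approx N"
proof (rule approxI)
  show "w = poly [:t * (partial (Suc N) - a 0):] (u N) + t ^ Suc (n N) * (tail N - a N) * poly 1 (u N)"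
    using w_tail[of N] by simp
qed (intro A.polys_over_pCons A.polys_over_0 A.polys_over_1 A.mult_mem A.diff_mem t_mem
    partial_mem a_mem)+

lemma u_mem_approx: "i \<le> N \<Longrightarrow> u i \<in> approx N"
proof (induction i rule: inc_induct)
  case base
  show ?case
    by (rule approxI[of _ "[:0, 1:]" _ 0])
      (simp_all add: A.polys_over_pCons A.polys_over_0)
next
  case (step i)
  interpret E: field_subring "approx N" by (rule field_subring_approx)
  obtain p q r where pqr: "p \<in> A" "q \<in> A" "r \<in> A" "u i = t * (p + q * w + r * u (Suc i))"
    using u_step by blast
  then have "t \<in> approx N" "p \<in> approx N" "q \<in> approx N" "r \<in> approx N"
    using A_subset_approx t_mem by simp_all
  then show ?case
    unfolding pqr(4) by (intro E.add_mem E.mult_mem w_mem_approx step.IH)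
qed

text \<open>Asking for all large \<open>N\<close> instead of some \<open>N\<close> lets two elements
  be placed in a common ring, as closure under the operations requires.\<close>

lemma C_subset_approx: "c \<in> C \<Longrightarrow> \<exists>N0. \<forall>N\<ge>N0. c \<in> approx N"
proof -
  have "C \<subseteq> {c. \<exists>N0. \<forall>N\<ge>N0. c \<in> approx N}"
  proof (rule C_least)
    show "field_subring {c. \<exists>N0. \<forall>N\<ge>N0. c \<in> approx N}"
    proof
      show "1 \<in> {c. \<exists>N0. \<forall>N\<ge>N0. c \<in> approx N}"
        using A_subset_approx by auto
      fix c c' assume "c \<in> {c. \<exists>N0. \<forall>N\<ge>N0. c \<in> approx N}" "c' \<in> {c. \<exists>N0. \<forall>N\<ge>N0. c \<in> approx N}"
      then obtain N0 N1 where N: "\<And>N. N \<ge> N0 \<Longrightarrow> c \<in> approx N" "\<And>N. N \<ge> N1 \<Longrightarrow> c' \<in> approx N"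
        by blast
      have "\<forall>N\<ge>max N0 N1. c - c' \<in> approx N"
        using N field_subring.diff_mem[OF field_subring_approx] by simp
      then show "c - c' \<in> {c. \<exists>N0. \<forall>N\<ge>N0. c \<in> approx N}"
        by blast
      have "\<forall>N\<ge>max N0 N1. c * c' \<in> approx N"
        using N field_subring.mult_mem[OF field_subring_approx] by simp
      then show "c * c' \<in> {c. \<exists>N0. \<forall>N\<ge>N0. c \<in> approx N}"
        by blast
    qed
    show "{c. \<exists>N0. \<forall>N\<ge>N0. c \<in> approx N} \<subseteq> R"
      using approx_subset_R by blast
  qed (use A_subset_approx w_mem_approx u_mem_approx in blast)+
  then show "c \<in> C \<Longrightarrow> \<exists>N0. \<forall>N\<ge>N0. c \<in> approx N"
    by blast
qed

text \<open>The aim is that \<open>w / t\<close> is no fraction \<open>f / g\<close> with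
  \<open>g\<close> outside \<open>M\<close>. Comparing the odd parts in \<open>s\<close> and
  cancelling \<open>t ^ k\<close> gives \<open>P + t * \<alpha> * Q = t * G\<close>, so the even
  part of \<open>g\<close> is divisible by \<open>t\<close>; its odd part carries
  \<open>t ^ k\<close> already.\<close>

lemma mult_w_eq_mult_t_imp_mem_M:
  assumes g: "g \<in> C" and f: "f \<in> C" and eq: "g * w = t * f"
  shows "g / t \<in> R"
proof -
  obtain N where N: "g \<in> approx N" "f \<in> approx N"
    using C_subset_approx[OF g] C_subset_approx[OF f] by (metis max.cobounded1 max.cobounded2)
  define s where "s = tail N - a N"
  define k where "k = Suc (n N)"
  define \<alpha> where "\<alpha> = partial (Suc N) - a 0"
  obtain P Q where P: "P \<in> polys_over A" "Q \<in> polys_over A"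
    and geq: "g = poly P (s ^ 2) + t ^ k * s * poly Q (s ^ 2)"
    using approxE[OF N(1)] unfolding s_def k_def u_def .
  obtain F G where F: "F \<in> polys_over A" "G \<in> polys_over A"
    and feq: "f = poly F (s ^ 2) + t ^ k * s * poly G (s ^ 2)"
    using approxE[OF N(2)] unfolding s_def k_def u_def .
  have \<alpha>: "\<alpha> \<in> A"
    unfolding \<alpha>_def by (intro A.diff_mem partial_mem a_mem)
  have w: "w = t * \<alpha> + t ^ k * s"
    unfolding \<alpha>_def k_def s_def by (rule w_tail)
  \<comment> \<open>\<open>E\<close> and \<open>t ^ k\<close> times \<open>D\<close> are the even
    and odd parts of \<open>g * w - t * f\<close> as a polynomial in \<open>s\<close>.\<close>
  define E where "E = Polynomial.smult (t * \<alpha>) P + Polynomial.smult (t ^ k * t ^ k) (pCons 0 Q) - Polynomial.smult t F"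
  define D where "D = P + Polynomial.smult t (Polynomial.smult \<alpha> Q - G)"
  have mem: "E \<in> polys_over A" "Polynomial.smult (t ^ k) D \<in> polys_over A"
    unfolding E_def D_def using P F \<alpha> t_mem
    by (simp_all add: A.polys_over_add A.polys_over_diff A.polys_over_smult A.polys_over_pCons
        A.mult_mem A.power_mem)
  have "poly E (s ^ 2) + s * poly (Polynomial.smult (t ^ k) D) (s ^ 2) = g * w - t * f"
    unfolding geq feq w E_def D_def by (simp add: algebra_simps power2_eq_square)
  then have "Polynomial.smult (t ^ k) D = 0"
    using eq by (intro tail_odd_part_eq_0[OF mem, of N]) (simp add: s_def)
  then have "poly D (s ^ 2) = 0"
    by simp
  then have "poly P (s ^ 2) = t * poly (G - Polynomial.smult \<alpha> Q) (s ^ 2)"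
    by (simp add: D_def algebra_simps)
  then have "g / t = poly (G - Polynomial.smult \<alpha> Q) (s ^ 2) + t ^ n N * s * poly Q (s ^ 2)"
    unfolding geq k_def by (simp add: field_simps)
  also have "\<dots> \<in> R"
    using P F \<alpha>
    by (intro R.add_mem R.mult_mem R.power_mem t_mem_R R.poly_mem[OF _ A_subset] A.polys_over_diff
        A.polys_over_smult) (simp_all add: s_def R.diff_mem tail_mem mem_R a_mem)
  finally show ?thesis .
qed


subsection \<open>The localization\<close>

abbreviation CM :: "'k set" where
  "CM \<equiv> akizuki_CM A R t a n"

lemma CM_eq: "CM = {f / g | f g. f \<in> C \<and> g \<in> C \<and> g / t \<notin> R}"
  unfolding akizuki_CM_def localization_at_def using mem_M_iff by auto

lemma inverse_mem_R: "g \<in> C \<Longrightarrow> g / t \<notin> R \<Longrightarrow> inverse g \<in> R"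
  by (intro unit_R mem_R_if_mem_C)

lemma CM_subset_R: "c \<in> CM \<Longrightarrow> c \<in> R"
  unfolding CM_eq using R.mult_mem[OF mem_R_if_mem_C inverse_mem_R]
  by (auto simp: divide_inverse[symmetric])

lemma CM_memI: "f \<in> C \<Longrightarrow> g \<in> C \<Longrightarrow> g / t \<notin> R \<Longrightarrow> f / g \<in> CM"
  unfolding CM_eq by blast

lemma one_div_t_notin_R: "1 / t \<notin> R"
  using inverse_t_notin_R by (simp add: inverse_eq_divide)

lemma C_subset_CM: "c \<in> C \<Longrightarrow> c \<in> CM"
  using CM_memI[of c 1] one_div_t_notin_R by simp

lemma field_subring_CM: "field_subring CM"
proof
  show "1 \<in> CM"
    by (rule C_subset_CM) simp
  fix x y assume "x \<in> CM" "y \<in> CM"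
  then obtain f g f' g' where f: "f \<in> C" "g \<in> C" "g / t \<notin> R" "x = f / g"
    and f': "f' \<in> C" "g' \<in> C" "g' / t \<notin> R" "y = f' / g'"
    unfolding CM_eq by blast
  have nz: "g \<noteq> 0" "g' \<noteq> 0"
    using f f' by auto
  have "g * g' / t \<notin> R"
  proof
    assume "g * g' / t \<in> R"
    then have "inverse g * (g * g' / t) \<in> R"
      using inverse_mem_R[OF f(2,3)] by (intro R.mult_mem)
    moreover have "inverse g * (g * g' / t) = g' / t"
      using nz by (simp add: field_simps)
    ultimately show False
      using f'(3) by (simp only:)
  qed
  then show "x - y \<in> CM" "x * y \<in> CM"
    using CM_memI[of "f * g' - f' * g" "g * g'"] CM_memI[of "f * f'" "g * g'"] f f' nz
    by (simp_all add: C.mult_mem C.diff_mem diff_frac_eq)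
qed

sublocale CM: field_subring CM
  by (rule field_subring_CM)

lemma A_subset_CM: "x \<in> A \<Longrightarrow> x \<in> CM" and w_mem_CM: "w \<in> CM" and t_mem_CM: "t \<in> CM"
  and u_mem_CM: "u i \<in> CM"
  using C_subset_CM A_subset_C w_mem_C t_mem_C u_mem_C by blast+

text \<open>Write \<open>g = x * (1 - e)\<close> with \<open>e\<close> in \<open>M\<close>. In 1/(1
  - e) = 1 + e + e^2/(1 - e) the last term is a multiple of \<open>t\<close>, because
  \<open>M_square\<close> makes e^2 divisible by \<open>t\<close> in \<open>C\<close>.\<close>

lemma CM_decomp_C:
  assumes "c \<in> CM"
  obtains b d where "b \<in> C" "d \<in> CM" "c = b + t * d"
proof -
  obtain f g where f: "f \<in> C" "g \<in> C" "g / t \<notin> R" "c = f / g"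
    using assms unfolding CM_eq by blast
  have nz: "g \<noteq> 0"
    using f by auto
  obtain x y d where d: "x \<in> A" "y \<in> A" "d \<in> C" "g = x + y * w + t * d"
    using C_decomp[OF f(2)] .
  \<comment> \<open>\<open>g\<close> differs from \<open>x\<close> by an element of
    \<open>M\<close>, so \<open>x\<close> is a unit of \<open>A\<close>.\<close>
  have m: "y * w + d * t \<in> M"
    using d A_subset_C by (intro M_add M_mult t_mem_M w_mem_M) simp_all
  have "x / t \<notin> R"
  proof
    assume "x / t \<in> R"
    then have "x / t + (y * w + d * t) / t \<in> R"
      using m mem_M_iff by (intro R.add_mem) simp_all
    then show False
      using f(3) d(4) by (simp add: field_simps)
  qed
  then have x: "inverse x \<in> C" "x \<noteq> 0"
    using unit_A[OF d(1)] A_subset_C mem_R by auto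
  define e where "e = - inverse x * (y * w + d * t)"
  have e: "e \<in> M"
    unfolding e_def using x m by (intro M_mult C.minus_mem)
  have "(e * e) / t \<in> C"
    using M_subset_C[OF M_square[OF e e]] .
  then have "((e * e / t) * f) / g \<in> CM"
    using f by (intro CM_memI C.mult_mem)
  moreover have "inverse x * (1 + e) * f \<in> C"
    using x e f M_subset_C by (intro C.mult_mem C.add_mem) simp_all
  moreover have "c = inverse x * (1 + e) * f + t * (((e * e / t) * f) / g)"
  proof -
    have xg: "inverse x * g = 1 - e"
      using x d(4) by (simp add: e_def field_simps)
    have "(inverse x * (1 + e) * f + t * (((e * e / t) * f) / g)) * g
        = (inverse x * g) * (1 + e) * f + e * e * f"
      using nz by (simp add: ring_distribs mult_ac)
    also have "\<dots> = f"
      unfolding xg by (simp add: algebra_simps)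
    finally show ?thesis
      by (simp only: f(4) nonzero_divide_eq_eq[OF nz])
  qed
  ultimately show ?thesis
    using that by blast
qed

lemma CM_decomp:
  assumes "c \<in> CM"
  shows "\<exists>x\<in>A. \<exists>y\<in>A. \<exists>d\<in>CM. c = x + y * w + t ^ m * d"
proof (induction m)
  case 0
  show ?case
    using assms by (intro bexI[of _ 0] bexI[of _ c]) simp_all
next
  case (Suc m)
  then obtain x y d where d: "x \<in> A" "y \<in> A" "d \<in> CM" "c = x + y * w + t ^ m * d"
    by blast
  obtain b d' where b: "b \<in> C" "d' \<in> CM" "d = b + t * d'"
    using CM_decomp_C[OF d(3)] .
  obtain x' y' d'' where b': "x' \<in> A" "y' \<in> A" "d'' \<in> C" "b = x' + y' * w + t * d''"
    using C_decomp[OF b(1)] .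
  have "c = (x + t ^ m * x') + (y + t ^ m * y') * w + t ^ Suc m * (d'' + d')"
    by (simp add: d(4) b(3) b'(4) algebra_simps)
  moreover have "x + t ^ m * x' \<in> A" "y + t ^ m * y' \<in> A" "d'' + d' \<in> CM"
    using d b b' t_mem C_subset_CM by (simp_all add: A.add_mem A.mult_mem A.power_mem CM.add_mem)
  ultimately show ?case by blast
qed

text \<open>Modulo \<open>t\<close> the term \<open>y * w\<close> vanishes in \<open>R\<close>,
  which settles \<open>x\<close>. If \<open>y\<close> were a unit of \<open>A\<close>, then
  \<open>w / t\<close> would lie in \<open>CM\<close>, contrary to
  \<open>mult_w_eq_mult_t_imp_mem_M\<close>.\<close>

lemma independent_step:
  assumes "x \<in> A" "y \<in> A" "(x + y * w) / t \<in> CM"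
  shows "x / t \<in> A" "y / t \<in> A"
proof -
  have "x / t = (x + y * w) / t - y * (w / t)"
    by (simp add: field_simps)
  also have "\<dots> \<in> R"
    using assms by (intro R.diff_mem R.mult_mem w_div_t_mem CM_subset_R mem_R)
  finally show x: "x / t \<in> A"
    using restricted assms(1) by blast
  show "y / t \<in> A"
  proof (rule ccontr)
    assume yt: "y / t \<notin> A"
    then have y: "inverse y \<in> A" "y \<noteq> 0"
      using unit_A[OF assms(2)] by auto
    have "w / t = inverse y * ((x + y * w) / t - x / t)"
      using y by (simp add: field_simps)
    also have "\<dots> \<in> CM"
      using CM.mult_mem[OF A_subset_CM[OF y(1)] CM.diff_mem[OF assms(3) A_subset_CM[OF x]]] .
    finally obtain f g where f: "f \<in> C" "g \<in> C" "g / t \<notin> R" "w / t = f / g"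
      unfolding CM_eq by blast
    then have "g * w = t * f"
      by (auto simp: field_simps)
    then show False
      using mult_w_eq_mult_t_imp_mem_M f by blast
  qed
qed

text \<open>Coefficients in \<open>K\<close> make this a statement about \<open>H1\<close>: together
  with \<open>L_decomp\<close> it identifies \<open>H1\<close>, as an \<open>A\<close>-module, with
  two copies of \<open>K / A\<close>. The denominators are removed one \<open>t\<close> at a
  time.\<close>

lemma independent:
  assumes "x \<in> K" "y \<in> K" "x + y * w \<in> CM"
  shows "x \<in> A" "y \<in> A"
proof -
  obtain k where "x * t ^ k \<in> A" "y * t ^ k \<in> A"
    using common_denominator[OF assms(1,2)] .
  then have "x \<in> A \<and> y \<in> A"
  proof (induction k)
    case (Suc k)
    have "(x * t ^ Suc k + (y * t ^ Suc k) * w) / t = t ^ k * (x + y * w)"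
      by (simp add: field_simps)
    also have "\<dots> \<in> CM"
      using assms(3) by (intro CM.mult_mem CM.power_mem t_mem_CM)
    finally have "x * t ^ Suc k / t \<in> A" "y * t ^ Suc k / t \<in> A"
      using independent_step[OF Suc.prems] by simp_all
    then show ?case
      by (intro Suc.IH) (simp_all add: mult.left_commute)
  qed simp
  then show "x \<in> A" "y \<in> A" by simp_all
qed


subsection \<open>Powers of the maximal ideal\<close>

abbreviation Mpow :: "nat \<Rightarrow> 'k set" where
  "Mpow m \<equiv> M [^]\<^bsub>ideals_set (embedded C)\<^esub> m"

lemma Mpow_0: "Mpow 0 = C"
  and Mpow_Suc: "Mpow (Suc m) = ideal_prod (embedded C) (Mpow m) M"
  by (simp_all add: nat_pow_def ideals_set_def)

text \<open>Each further factor from \<open>M\<close> yields a \<open>t\<close> by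
  \<open>M_square\<close>. With \<open>t_power_mem_Mpow\<close> the \<open>M\<close>-adic and
  \<open>t\<close>-adic topologies agree up to a shift by one.\<close>

lemma Mpow_Suc_div: "c \<in> Mpow (Suc m) \<Longrightarrow> c / t ^ m \<in> M"
proof (induction m arbitrary: c)
  case 0
  then have "c \<in> ideal_prod (embedded C) C M"
    by (simp only: Mpow_Suc[of 0] Mpow_0)
  then have "c \<in> M"
    by induction (simp_all add: M_mult M_add)
  then show ?case by simp
next
  case (Suc m)
  then have "c \<in> ideal_prod (embedded C) (Mpow (Suc m)) M"
    by (simp only: Mpow_Suc[of "Suc m"])
  then show ?case
  proof induction
    case (prod i j)
    then show ?case
      using M_square[OF Suc.IH[OF prod(1)] prod(2)] by (simp add: field_simps)
  next
    case (sum c d)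
    then show ?case
      using M_add by (simp add: add_divide_distrib)
  qed
qed

lemma t_power_mem_Mpow: "t ^ m \<in> Mpow m"
proof (induction m)
  case (Suc m)
  then show ?case
    using ideal_prod.prod[of "t ^ m" "Mpow m" t M "embedded C"] t_mem_M
    by (simp only: Mpow_Suc) (simp add: mult.commute)
qed (simp only: Mpow_0 power_0 C.one_mem)

abbreviation MpowCM :: "nat \<Rightarrow> 'k set" where
  "MpowCM \<equiv> akizuki_MpowCM A R t a n"

lemma t_power_mult_mem_MpowCM: "d \<in> CM \<Longrightarrow> t ^ m * d \<in> MpowCM m"
  using t_power_mem_Mpow[of m] ideal.I_l_closed[of _ "embedded CM" "t ^ m" d]
  unfolding akizuki_MpowCM_def genideal_def by (auto simp: mult.commute)

lemma MpowCM_Suc_div: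
  assumes "f \<in> MpowCM (Suc m)"
  shows "f / t ^ m \<in> CM"
proof -
  have "ideal {c \<in> CM. c / t ^ m \<in> CM} (embedded CM)"
  proof (rule CM.ideal_embedded)
    show "x + y \<in> {c \<in> CM. c / t ^ m \<in> CM}"
      if "x \<in> {c \<in> CM. c / t ^ m \<in> CM}" "y \<in> {c \<in> CM. c / t ^ m \<in> CM}" for x y
      using that CM.add_mem by (simp add: add_divide_distrib)
    show "c * x \<in> {c \<in> CM. c / t ^ m \<in> CM}" if "c \<in> CM" "x \<in> {c \<in> CM. c / t ^ m \<in> CM}" for c x
      using that CM.mult_mem[of c x] CM.mult_mem[of c "x / t ^ m"] by simp
  qed auto
  moreover have "Mpow (Suc m) \<subseteq> {c \<in> CM. c / t ^ m \<in> CM}"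
  proof
    fix c assume "c \<in> Mpow (Suc m)"
    then have c: "c / t ^ m \<in> CM"
      by (intro C_subset_CM M_subset_C Mpow_Suc_div)
    moreover have "t ^ m * (c / t ^ m) \<in> CM"
      using c by (intro CM.mult_power_mem t_mem_CM)
    ultimately show "c \<in> {c \<in> CM. c / t ^ m \<in> CM}"
      by simp
  qed
  ultimately have "MpowCM (Suc m) \<subseteq> {c \<in> CM. c / t ^ m \<in> CM}"
    unfolding akizuki_MpowCM_def genideal_def by blast
  then show ?thesis
    using assms by blast
qed


subsection \<open>Local cohomology\<close>

abbreviation L :: "'k set" where
  "L \<equiv> localization_away CM t"

abbreviation H1 :: "('k, 'k set) module" where
  "H1 \<equiv> akizuki_H1 A R t a n"

abbreviation coset :: "'k \<Rightarrow> 'k set" where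
  "coset h \<equiv> CM +>\<^bsub>embedded L\<^esub> h"

lemma mem_L_iff: "h \<in> L \<longleftrightarrow> (\<exists>m. h * t ^ m \<in> CM)"
proof
  assume "h \<in> L"
  then show "\<exists>m. h * t ^ m \<in> CM"
    unfolding localization_away_def using nonzero_eq_divide_eq[of "t ^ _" h] by auto
next
  assume "\<exists>m. h * t ^ m \<in> CM"
  then obtain m where "h * t ^ m \<in> CM" "h = (h * t ^ m) / t ^ m"
    by auto
  then show "h \<in> L"
    unfolding localization_away_def by blast
qed

lemma L_add:
  assumes "h \<in> L" "h' \<in> L"
  shows "h + h' \<in> L"
proof -
  obtain i j where "h * t ^ i \<in> CM" "h' * t ^ j \<in> CM"
    using assms mem_L_iff by blast
  then have "t ^ j * (h * t ^ i) + t ^ i * (h' * t ^ j) \<in> CM"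
    using t_mem_CM by (intro CM.add_mem CM.mult_power_mem)
  then have "(h + h') * t ^ (i + j) \<in> CM"
    by (simp add: power_add algebra_simps)
  then show ?thesis
    unfolding mem_L_iff by blast
qed

lemma L_mult:
  assumes "c \<in> CM" "h \<in> L"
  shows "c * h \<in> L"
proof -
  obtain i where "h * t ^ i \<in> CM"
    using assms mem_L_iff by blast
  then have "c * h * t ^ i \<in> CM"
    using CM.mult_mem[OF assms(1), of "h * t ^ i"] by (simp add: mult.assoc)
  then show ?thesis
    unfolding mem_L_iff by blast
qed

lemma L_diff: "h \<in> L \<Longrightarrow> h' \<in> L \<Longrightarrow> h - h' \<in> L"
  using L_add[of h "- 1 * h'"] L_mult[of "- 1" h'] CM.minus_mem[OF CM.one_mem] by simp

lemma L_decomp: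
  assumes "h \<in> L"
  obtains x y where "x \<in> K" "y \<in> K" "h - (x + y * w) \<in> CM"
proof -
  obtain m where "h * t ^ m \<in> CM"
    using assms mem_L_iff by blast
  then obtain x y d where d: "x \<in> A" "y \<in> A" "d \<in> CM" "h * t ^ m = x + y * w + t ^ m * d"
    using CM_decomp by blast
  then have "h - (x / t ^ m + y / t ^ m * w) = d"
    by (simp add: field_simps)
  then show ?thesis
    using that[OF div_power_mem_K[OF d(1), of m] div_power_mem_K[OF d(2), of m]] d(3)
    by (simp only:)
qed

lemma carrier_H1: "carrier H1 = coset ` L"
  unfolding akizuki_H1_def by (rule carrier_quotient_module)

lemma H1_add: "coset h \<oplus>\<^bsub>H1\<^esub> coset h' = coset (h + h')"
  unfolding akizuki_H1_def by (rule CM.quotient_add)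

lemma H1_smult: "c \<in> CM \<Longrightarrow> c \<odot>\<^bsub>H1\<^esub> coset h = coset (c * h)"
  unfolding akizuki_H1_def by (rule CM.quotient_smult)

section \<open>Continuous homomorphisms into \<open>K / A\<close>\<close>

abbreviation Homc :: "('k, 'k \<Rightarrow> 'k set) module" where
  "Homc \<equiv> akizuki_Homc A R t a n"

lemma mem_HomcD:
  assumes "\<phi> \<in> carrier Homc"
  shows "\<phi> \<in> CM \<rightarrow>\<^sub>E range frac_class"
    and "\<And>f g. f \<in> CM \<Longrightarrow> g \<in> CM \<Longrightarrow> \<phi> (f + g) = \<phi> f \<oplus>\<^bsub>frac_quotient A\<^esub> \<phi> g"
    and "\<And>c f. c \<in> A \<Longrightarrow> f \<in> CM \<Longrightarrow> \<phi> (c * f) = c \<odot>\<^bsub>frac_quotient A\<^esub> \<phi> f"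
    and "\<exists>m. \<forall>f\<in>MpowCM m. \<phi> f = frac_class 0"
  using assms
  by (simp_all add: akizuki_Homc_def module_homs_def carrier_frac_quotient zero_frac_quotient)

lemma mem_HomcI:
  assumes "\<phi> \<in> CM \<rightarrow>\<^sub>E range frac_class"
    and "\<And>f g. f \<in> CM \<Longrightarrow> g \<in> CM \<Longrightarrow> \<phi> (f + g) = \<phi> f \<oplus>\<^bsub>frac_quotient A\<^esub> \<phi> g"
    and "\<And>c f. c \<in> A \<Longrightarrow> f \<in> CM \<Longrightarrow> \<phi> (c * f) = c \<odot>\<^bsub>frac_quotient A\<^esub> \<phi> f"
    and "\<And>f. f \<in> MpowCM m \<Longrightarrow> \<phi> f = frac_class 0"
  shows "\<phi> \<in> carrier Homc"
proof -
  have "\<exists>m. \<forall>f\<in>MpowCM m. \<phi> f = frac_class 0"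
    using assms(4) by blast
  then show ?thesis
    using assms(1-3)
    by (simp add: akizuki_Homc_def module_homs_def carrier_frac_quotient zero_frac_quotient)
qed

end


section \<open>The residue pairing\<close>

locale akizuki_residue = akizuki A R t a n z
  for A R :: "'k::field set" and t :: 'k and a n z +
  fixes \<sigma> \<rho> :: 'k
  assumes sigma_mem: "\<sigma> \<in> R" and rho_mem: "\<rho> \<in> R"
    and rho_unit: "inverse \<rho> \<in> R" and rho_nonzero: "\<rho> \<noteq> 0"
begin

definition res :: "'k \<Rightarrow> 'k set" where
  "res h = akizuki_res A R t a n \<sigma> \<rho> (coset h)"

text \<open>By \<open>independent\<close>, two representations of a class differ by coefficients in
  \<open>A\<close>; as \<open>\<sigma>\<close> and \<open>\<rho>\<close> lie in \<open>R\<close>,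
  the residue is unambiguous. Coefficients in \<open>K\<close> absorb the denominator.\<close>

lemma res_eq:
  assumes x: "x \<in> K" and y: "y \<in> K" and h: "h - (x + y * w) \<in> CM"
  shows "res h = frac_class (x * \<sigma> + y * \<rho>)"
  unfolding res_def akizuki_res_def
proof (rule the_equality)
  obtain k where k: "k > 0" "x * t ^ k \<in> A" "y * t ^ k \<in> A"
    using common_denominator[OF x y] .
  have "coset h = genfrac_CM A R t a n (x * t ^ k + (y * t ^ k) * w) k"
    using h by (simp add: genfrac_CM_def CM.coset_eq_iff add_divide_distrib)
  moreover have "frac_class (x * \<sigma> + y * \<rho>) = genfrac_A A R t (x * t ^ k * \<sigma> + y * t ^ k * \<rho>) k"
    by (simp add: genfrac_A_eq add_divide_distrib)
  ultimately show "\<exists>x'\<in>A. \<exists>y'\<in>A. \<exists>m>0. coset h = genfrac_CM A R t a n (x' + y' * w) m \<and>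
      frac_class (x * \<sigma> + y * \<rho>) = genfrac_A A R t (x' * \<sigma> + y' * \<rho>) m"
    using k by blast
next
  fix \<eta>
  assume "\<exists>x'\<in>A. \<exists>y'\<in>A. \<exists>m>0. coset h = genfrac_CM A R t a n (x' + y' * w) m \<and>
      \<eta> = genfrac_A A R t (x' * \<sigma> + y' * \<rho>) m"
  then obtain x' y' m where x': "x' \<in> A" "y' \<in> A" "m > 0"
    and "coset h = genfrac_CM A R t a n (x' + y' * w) m"
    and \<eta>: "\<eta> = genfrac_A A R t (x' * \<sigma> + y' * \<rho>) m"
    by blast
  then have h': "h - (x' + y' * w) / t ^ m \<in> CM"
    by (simp add: genfrac_CM_def CM.coset_eq_iff)
  have "(x' / t ^ m - x) + (y' / t ^ m - y) * w = (h - (x + y * w)) - (h - (x' + y' * w) / t ^ m)"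
    by (simp add: add_divide_distrib algebra_simps)
  also have "\<dots> \<in> CM"
    using h h' by (rule CM.diff_mem)
  finally have "x' / t ^ m - x \<in> A" "y' / t ^ m - y \<in> A"
    using independent K.diff_mem[OF div_power_mem_K] x y x' by blast+
  then have "(x' / t ^ m - x) * \<sigma> + (y' / t ^ m - y) * \<rho> \<in> R"
    by (intro R.add_mem R.mult_mem sigma_mem rho_mem mem_R)
  moreover have "(x' / t ^ m - x) * \<sigma> + (y' / t ^ m - y) * \<rho>
      = (x' * \<sigma> + y' * \<rho>) / t ^ m - (x * \<sigma> + y * \<rho>)"
    by (simp add: add_divide_distrib algebra_simps)
  ultimately show "\<eta> = frac_class (x * \<sigma> + y * \<rho>)"
    by (simp add: \<eta> genfrac_A_eq frac_class_eq_iff)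
qed

lemma res_CM: "c \<in> CM \<Longrightarrow> res c = frac_class 0"
  using res_eq[of 0 0 c] by simp

lemma res_in_range: "h \<in> L \<Longrightarrow> res h \<in> range frac_class"
  by (metis L_decomp res_eq rangeI)

lemma res_add:
  assumes "h \<in> L" "h' \<in> L"
  shows "res (h + h') = res h \<oplus>\<^bsub>frac_quotient A\<^esub> res h'"
proof -
  obtain x y where x: "x \<in> K" "y \<in> K" "h - (x + y * w) \<in> CM"
    using L_decomp[OF assms(1)] .
  obtain x' y' where x': "x' \<in> K" "y' \<in> K" "h' - (x' + y' * w) \<in> CM"
    using L_decomp[OF assms(2)] .
  have "h + h' - ((x + x') + (y + y') * w) \<in> CM"
    using CM.add_mem[OF x(3) x'(3)] by (simp add: algebra_simps)
  then have "res (h + h') = frac_class ((x + x') * \<sigma> + (y + y') * \<rho>)"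
    using x x' by (intro res_eq K.add_mem)
  then show ?thesis
    by (simp add: res_eq[OF x] res_eq[OF x'] frac_class_add algebra_simps)
qed

lemma res_smult:
  assumes "c \<in> A" "h \<in> L"
  shows "res (c * h) = c \<odot>\<^bsub>frac_quotient A\<^esub> res h"
proof -
  obtain x y where x: "x \<in> K" "y \<in> K" "h - (x + y * w) \<in> CM"
    using L_decomp[OF assms(2)] .
  have "c * h - (c * x + c * y * w) \<in> CM"
    using CM.mult_mem[OF A_subset_CM[OF assms(1)] x(3)] by (simp add: algebra_simps)
  then have "res (c * h) = frac_class (c * x * \<sigma> + c * y * \<rho>)"
    using x A_subset_K[OF assms(1)] by (intro res_eq K.mult_mem)
  then show ?thesis
    using assms(1) by (simp add: res_eq[OF x] frac_class_smult algebra_simps)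
qed

lemma res_diff_eq_0:
  assumes "h \<in> L" "h' \<in> L" "res h = res h'"
  shows "res (h - h') = frac_class 0"
proof -
  have "- 1 \<in> A"
    by (intro A.minus_mem A.one_mem)
  then have "res (h - h') = res h' \<oplus>\<^bsub>frac_quotient A\<^esub> (- 1) \<odot>\<^bsub>frac_quotient A\<^esub> res h'"
    using res_add[OF assms(1) L_mult[OF A_subset_CM assms(2)], of "- 1"] res_smult[of "- 1", OF _ assms(2)] assms(3)
    by simp
  also obtain v where "res h' = frac_class v"
    using res_in_range[OF assms(2)] by blast
  with \<open>- 1 \<in> A\<close> have "res h' \<oplus>\<^bsub>frac_quotient A\<^esub> (- 1) \<odot>\<^bsub>frac_quotient A\<^esub> res h' = frac_class 0"
    by (simp add: frac_class_smult frac_class_add)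
  finally show ?thesis .
qed

section \<open>The map from local cohomology to continuous homomorphisms\<close>

abbreviation \<Phi> :: "'k set \<Rightarrow> 'k \<Rightarrow> 'k set" where
  "\<Phi> \<equiv> akizuki_Phi A R t a n \<sigma> \<rho>"

lemma Phi_coset: "h \<in> L \<Longrightarrow> \<Phi> (coset h) = (\<lambda>f\<in>CM. res (f * h))"
  by (simp add: akizuki_Phi_def carrier_H1 H1_smult res_def cong: restrict_cong)

lemma Phi_mem_Homc:
  assumes h: "h \<in> L"
  shows "\<Phi> (coset h) \<in> carrier Homc"
proof -
  obtain m where m: "h * t ^ m \<in> CM"
    using h mem_L_iff by blast
  show ?thesis
  \<comment> \<open>One more than the pole order \<open>m\<close> of \<open>h\<close>, because
    \<open>MpowCM_Suc_div\<close> loses one power.\<close>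
  proof (rule mem_HomcI[of _ "Suc m"])
    show "\<Phi> (coset h) \<in> CM \<rightarrow>\<^sub>E range frac_class"
      using res_in_range[OF L_mult[OF _ h]] by (simp add: Phi_coset[OF h])
    show "\<Phi> (coset h) (f + g) = \<Phi> (coset h) f \<oplus>\<^bsub>frac_quotient A\<^esub> \<Phi> (coset h) g"
      if "f \<in> CM" "g \<in> CM" for f g
      using that res_add[OF L_mult[OF _ h] L_mult[OF _ h], of f g]
      by (simp add: Phi_coset[OF h] CM.add_mem distrib_right)
    show "\<Phi> (coset h) (c * f) = c \<odot>\<^bsub>frac_quotient A\<^esub> \<Phi> (coset h) f" if "c \<in> A" "f \<in> CM" for c f
      using that res_smult[OF that(1) L_mult[OF that(2) h]]
      by (simp add: Phi_coset[OF h] CM.mult_mem A_subset_CM mult.assoc)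
    fix f assume "f \<in> MpowCM (Suc m)"
    then have f: "f / t ^ m \<in> CM"
      by (rule MpowCM_Suc_div)
    have "f \<in> CM"
      using CM.mult_power_mem[OF f t_mem_CM, of m] by simp
    moreover have "f * h \<in> CM"
      using CM.mult_mem[OF f m] by simp
    ultimately show "\<Phi> (coset h) f = frac_class 0"
      by (simp add: Phi_coset[OF h] res_CM)
  qed
qed

lemma Phi_module_hom: "\<Phi> \<in> module_homs (embedded CM) H1 Homc"
proof -
  have "\<Phi> \<in> carrier H1 \<rightarrow>\<^sub>E carrier Homc"
    using Phi_mem_Homc by (auto simp: carrier_H1 akizuki_Phi_def)
  moreover have "\<Phi> (coset h \<oplus>\<^bsub>H1\<^esub> coset h') = \<Phi> (coset h) \<oplus>\<^bsub>Homc\<^esub> \<Phi> (coset h')"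
    if "h \<in> L" "h' \<in> L" for h h'
  proof -
    have "res (f * (h + h')) = res (f * h) \<oplus>\<^bsub>frac_quotient A\<^esub> res (f * h')" if "f \<in> CM" for f
      using res_add[OF L_mult[OF that] L_mult[OF that], of h h'] \<open>h \<in> L\<close> \<open>h' \<in> L\<close>
      by (simp add: distrib_left)
    then show ?thesis
      using that by (simp add: H1_add Phi_coset L_add akizuki_Homc_def cong: restrict_cong)
  qed
  moreover have "\<Phi> (c \<odot>\<^bsub>H1\<^esub> coset h) = c \<odot>\<^bsub>Homc\<^esub> \<Phi> (coset h)" if "c \<in> CM" "h \<in> L" for c h
    using that
    by (simp add: H1_smult Phi_coset L_mult akizuki_Homc_def CM.mult_mem mult_ac cong: restrict_cong)
  ultimately show ?thesis
    by (simp add: module_homs_def carrier_H1)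
qed

section \<open>Nondegeneracy of the pairing, injectivity and surjectivity\<close>

lemma mult_rho_mem_iff: "v * \<rho> \<in> R \<longleftrightarrow> v \<in> R"
proof
  assume "v * \<rho> \<in> R"
  then have "v * \<rho> * inverse \<rho> \<in> R"
    using rho_unit by (rule R.mult_mem)
  moreover have "v * \<rho> * inverse \<rho> = v"
    using rho_nonzero by simp
  ultimately show "v \<in> R"
    by (simp only:)
qed (rule R.mult_mem[OF _ rho_mem])

text \<open>As \<open>w\<^sup>2\<close> lies in \<open>t\<^sup>2C\<close>, the residue of \<open>wd\<close> sees only the constant term of the class of \<open>d\<close>.\<close>

lemma res_nondegenerate_socle:
  assumes d: "t * d \<in> CM" "res d = frac_class 0" "res (w * d) = frac_class 0"
  shows "d \<in> CM"
proof -
  obtain \<xi> \<eta> c where \<xi>: "\<xi> \<in> A" "\<eta> \<in> A" "c \<in> CM" "t * d = \<xi> + \<eta> * w + t * c"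
    using CM_decomp[OF d(1), of 1] unfolding power_one_right by blast
  have K: "\<xi> / t \<in> K" "\<eta> / t \<in> K"
    using div_power_mem_K[of _ 1] \<xi> by simp_all
  have eq: "d = \<xi> / t + \<eta> / t * w + c"
  proof -
    have "t * d = t * (\<xi> / t + \<eta> / t * w + c)"
      by (simp add: \<xi>(4) distrib_left)
    then show ?thesis by simp
  qed
  have "w * d = \<xi> / t * w + \<eta> / t * (w * w) + w * c"
    by (simp add: eq algebra_simps)
  then have "w * d - (0 + \<xi> / t * w) = \<eta> * t * u 0 + w * c"
    unfolding w_square by (simp add: power2_eq_square)
  moreover have "\<eta> * t * u 0 + w * c \<in> CM"
    by (intro CM.add_mem CM.mult_mem A_subset_CM[OF \<xi>(2)] t_mem_CM u_mem_CM w_mem_CM \<xi>(3))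
  ultimately have "res (w * d) = frac_class (0 * \<sigma> + \<xi> / t * \<rho>)"
    using K by (intro res_eq K.zero_mem) simp_all
  then have "frac_class (\<xi> / t * \<rho>) = frac_class 0"
    using d(3) by simp
  \<comment> \<open>This coefficient is now integral, so in the residue of \<open>d\<close> the
    \<open>\<rho>\<close> term alone is left to test.\<close>
  then have x: "\<xi> / t \<in> R"
    by (simp only: frac_class_eq_0_iff mult_rho_mem_iff)
  have "res d = frac_class (\<xi> / t * \<sigma> + \<eta> / t * \<rho>)"
    using K \<xi>(3) by (intro res_eq) (simp_all add: eq)
  then have "\<xi> / t * \<sigma> + \<eta> / t * \<rho> \<in> R"
    using d(2) frac_class_eq_0_iff by metis
  then have "(\<xi> / t * \<sigma> + \<eta> / t * \<rho>) - \<xi> / t * \<sigma> \<in> R"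
    using x by (intro R.diff_mem R.mult_mem sigma_mem)
  then have "\<eta> / t \<in> R"
    using mult_rho_mem_iff[of "\<eta> / t"] by simp
  with x have "\<xi> / t \<in> CM" "\<eta> / t \<in> CM"
    by (simp_all add: A_subset_CM restricted \<xi>)
  then show ?thesis
    unfolding eq using \<xi>(3) by (intro CM.add_mem CM.mult_mem w_mem_CM)
qed

text \<open>The pole order is lowered one step at a time: the class of \<open>t ^ m * d\<close> is
  killed by \<open>t\<close>, and the hypothesis passes to it since \<open>CM\<close> contains
  \<open>t ^ m\<close>.\<close>

lemma res_nondegenerate:
  assumes "d \<in> L" "\<And>f. f \<in> CM \<Longrightarrow> res (f * d) = frac_class 0"
  shows "d \<in> CM"
proof -
  have "d * t ^ m \<in> CM \<Longrightarrow> d \<in> CM" for m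
  proof (induction m)
    case (Suc m)
    define e where "e = t ^ m * d"
    have "res (f * e) = frac_class 0" if "f \<in> CM" for f
      using assms(2)[of "f * t ^ m"] CM.mult_mem[OF that CM.power_mem[OF t_mem_CM]]
      by (simp only: e_def mult.assoc)
    from this[OF CM.one_mem] this[OF w_mem_CM]
    have "res e = frac_class 0" "res (w * e) = frac_class 0"
      by simp_all
    moreover have "t * e \<in> CM"
      using Suc.prems by (simp add: e_def mult_ac)
    ultimately have "e \<in> CM"
      by (rule res_nondegenerate_socle[rotated])
    then show ?case
      by (intro Suc.IH) (simp only: e_def mult.commute)
  qed simp
  then show ?thesis
    using assms(1) mem_L_iff by blast
qed

lemma Phi_inj: "inj_on \<Phi> (carrier H1)"
proof (rule inj_onI)
  fix \<omega> \<omega>' assume "\<omega> \<in> carrier H1" "\<omega>' \<in> carrier H1" and eq: "\<Phi> \<omega> = \<Phi> \<omega>'"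
  then obtain h h' where h: "h \<in> L" "\<omega> = coset h" and h': "h' \<in> L" "\<omega>' = coset h'"
    by (auto simp: carrier_H1)
  have "h - h' \<in> CM"
  proof (rule res_nondegenerate)
    show "h - h' \<in> L"
      using h(1) h'(1) by (rule L_diff)
    fix f assume f: "f \<in> CM"
    have "res (f * h) = res (f * h')"
      using fun_cong[OF eq, of f] f by (simp add: Phi_coset h h')
    then show "res (f * (h - h')) = frac_class 0"
      using res_diff_eq_0[OF L_mult[OF f h(1)] L_mult[OF f h'(1)]] by (simp add: right_diff_distrib)
  qed
  then show "\<omega> = \<omega>'"
    by (simp add: h h' CM.coset_eq_iff)
qed

text \<open>The unknowns are the coefficients of \<open>\<xi> + \<eta> * w\<close>. When
  \<open>w * w\<close> is replaced by \<open>t * p + t * q * w\<close>, the left sides are, up to a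
  common denominator, the residues of this element and of its multiple by \<open>w\<close>.\<close>

lemma solve_system:
  assumes "p \<in> R" "q \<in> R" "b \<in> R" "c \<in> R"
  obtains \<xi> \<eta> where "\<xi> \<in> R" "\<eta> \<in> R" "\<xi> * \<sigma> + \<eta> * \<rho> = b"
    "\<xi> * \<rho> + \<eta> * (t * p * \<sigma> + t * q * \<rho>) = c"
proof -
  define E where "E = t * p * \<sigma> + t * q * \<rho>"
  define D where "D = \<rho> * \<rho> - \<sigma> * E"
  have E: "E \<in> R"
    unfolding E_def by (intro R.add_mem R.mult_mem t_mem_R assms sigma_mem rho_mem)
  have D: "D \<in> R"
    unfolding D_def by (intro R.diff_mem R.mult_mem E sigma_mem rho_mem)
  have "D / t \<notin> R"
  proof
    assume "D / t \<in> R"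
    then have "D / t + \<sigma> * (p * \<sigma> + q * \<rho>) \<in> R"
      by (intro R.add_mem R.mult_mem assms sigma_mem rho_mem)
    moreover have "D / t + \<sigma> * (p * \<sigma> + q * \<rho>) = 1 / t * \<rho> * \<rho>"
      by (simp add: D_def E_def field_simps)
    ultimately show False
      using one_div_t_notin_R mult_rho_mem_iff by metis
  qed
  then have iD: "inverse D \<in> R" "D \<noteq> 0"
    using unit_R[OF D] by auto
  show ?thesis
  \<comment> \<open>Cramer's rule; \<open>D\<close> is the negative of the determinant.\<close>
  proof (rule that)
    show "inverse D * (\<rho> * c - E * b) \<in> R" "inverse D * (\<rho> * b - \<sigma> * c) \<in> R"
      by (intro R.diff_mem R.mult_mem iD assms E sigma_mem rho_mem)+
    have "(inverse D * (\<rho> * c - E * b)) * \<sigma> + (inverse D * (\<rho> * b - \<sigma> * c)) * \<rho> = inverse D * (D * b)"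
      unfolding D_def by (simp add: algebra_simps)
    then show "(inverse D * (\<rho> * c - E * b)) * \<sigma> + (inverse D * (\<rho> * b - \<sigma> * c)) * \<rho> = b"
      using iD by simp
    have "(inverse D * (\<rho> * c - E * b)) * \<rho> + (inverse D * (\<rho> * b - \<sigma> * c)) * E = inverse D * (D * c)"
      unfolding D_def by (simp add: algebra_simps)
    then show "(inverse D * (\<rho> * c - E * b)) * \<rho>
        + (inverse D * (\<rho> * b - \<sigma> * c)) * (t * p * \<sigma> + t * q * \<rho>) = c"
      using iD by (simp add: E_def)
  qed
qed

text \<open>Continuity makes \<open>\<phi>\<close> vanish on \<open>t ^ m\<close> times
  \<open>CM\<close>, so it is determined by its values at 1 and \<open>w\<close>, both killed by
  \<open>t ^ m\<close>. It suffices to find \<open>h\<close> with these two residues and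
  \<open>t ^ m * h\<close> in \<open>CM\<close>.\<close>

lemma Phi_surj:
  assumes \<phi>: "\<phi> \<in> carrier Homc"
  shows "\<phi> \<in> \<Phi> ` carrier H1"
proof -
  note \<phi>_ext = mem_HomcD(1)[OF \<phi>] and \<phi>_add = mem_HomcD(2)[OF \<phi>] and \<phi>_smult = mem_HomcD(3)[OF \<phi>]
  obtain m where m: "\<And>f. f \<in> MpowCM m \<Longrightarrow> \<phi> f = frac_class 0"
    using mem_HomcD(4)[OF \<phi>] by blast
  have \<phi>_vanish: "\<phi> (t ^ m * d) = frac_class 0" if "d \<in> CM" for d
    using m t_power_mult_mem_MpowCM[OF that] by blast
  have \<phi>_value: "\<exists>v. \<phi> f = frac_class v \<and> t ^ m * v \<in> R" if f: "f \<in> CM" for f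
  proof -
    obtain v where v: "\<phi> f = frac_class v"
      using \<phi>_ext f by (auto simp: PiE_iff)
    have "t ^ m \<in> A"
      using t_mem by (rule A.power_mem)
    then have "frac_class (t ^ m * v) = frac_class 0"
      using \<phi>_smult[of "t ^ m" f] \<phi>_vanish[OF f] f by (simp add: v frac_class_smult)
    then show ?thesis
      using v by (intro exI[of _ v]) (simp add: frac_class_eq_0_iff)
  qed
  obtain b where b: "\<phi> 1 = frac_class b" "t ^ m * b \<in> R"
    using \<phi>_value[OF CM.one_mem] by blast
  obtain c where c: "\<phi> w = frac_class c" "t ^ m * c \<in> R"
    using \<phi>_value[OF w_mem_CM] by blast
  \<comment> \<open>Precision \<open>m\<close> gives \<open>w * w\<close> up to a multiple of
    \<open>t ^ m\<close> in \<open>CM\<close>, which suits an \<open>h\<close> with denominator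
    \<open>t ^ m\<close>.\<close>
  obtain p q d0 where p: "p \<in> A" "q \<in> A" "d0 \<in> CM" and u0: "u 0 = p + q * w + t ^ m * d0"
    using CM_decomp[OF u_mem_CM] by blast
  obtain \<xi> \<eta> where \<xi>: "\<xi> \<in> R" "\<eta> \<in> R" "\<xi> * \<sigma> + \<eta> * \<rho> = t ^ m * b"
    "\<xi> * \<rho> + \<eta> * (t * (t * p) * \<sigma> + t * (t * q) * \<rho>) = t ^ m * c"
    \<comment> \<open>Of the two factors \<open>t\<close> in \<open>w * w = t ^ 2 * u 0\<close>, one
      is built into \<open>solve_system\<close> and the other is passed in its arguments.\<close>
    using solve_system[of "t * p" "t * q", OF _ _ b(2) c(2)] p mem_R R.mult_mem t_mem_R by metis
  \<comment> \<open>An error divisible by \<open>t ^ m\<close> in \<open>R\<close> disappears in the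
    residues, so the solution over the completion can be replaced by coefficients in
    \<open>A\<close>.\<close>
  obtain x y where x: "x \<in> A" "(\<xi> - x) / t ^ m \<in> R" and y: "y \<in> A" "(\<eta> - y) / t ^ m \<in> R"
    using dense[OF \<xi>(1)] dense[OF \<xi>(2)] by metis
  define h where "h = (x + y * w) / t ^ m"
  have th: "t ^ m * h = x + y * w"
    by (simp add: h_def)
  have th_CM: "t ^ m * h \<in> CM"
    unfolding th using x y by (intro CM.add_mem CM.mult_mem A_subset_CM w_mem_CM)
  then have h: "h \<in> L"
    unfolding mem_L_iff by (metis mult.commute)
  have res_h: "res h = \<phi> 1"
  proof -
    have "b - (x / t ^ m * \<sigma> + y / t ^ m * \<rho>) = (\<xi> - x) / t ^ m * \<sigma> + (\<eta> - y) / t ^ m * \<rho>"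
    proof -
      have "b = (\<xi> * \<sigma> + \<eta> * \<rho>) / t ^ m"
        unfolding \<xi>(3) by simp
      then show ?thesis
        by (simp add: field_simps)
    qed
    also have "\<dots> \<in> R"
      by (intro R.add_mem R.mult_mem x y sigma_mem rho_mem)
    finally have "frac_class b = frac_class (x / t ^ m * \<sigma> + y / t ^ m * \<rho>)"
      by (simp only: frac_class_eq_iff)
    moreover have "h - (x / t ^ m + y / t ^ m * w) = 0"
      by (simp add: h_def field_simps)
    ultimately show ?thesis
      using res_eq[OF div_power_mem_K[OF x(1), of m] div_power_mem_K[OF y(1), of m], of h]
      by (simp add: b(1))
  qed
  have res_wh: "res (w * h) = \<phi> w"
  proof -
    define P where "P = t * (t * p)"
    define Q where "Q = t * (t * q)"
    have PQ: "P \<in> A" "Q \<in> A"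
      unfolding P_def Q_def using p t_mem by (simp_all add: A.mult_mem)
    have ww: "w * w = P + Q * w + t ^ m * (t * (t * d0))"
      unfolding w_square u0 by (simp add: P_def Q_def power2_eq_square algebra_simps)
    have "w * h = (x * w + y * (w * w)) / t ^ m"
      by (simp add: h_def algebra_simps)
    then have "w * h - (y * P / t ^ m + (x + y * Q) / t ^ m * w) = y * (t * (t * d0))"
      unfolding ww by (simp add: field_simps)
    moreover have "y * (t * (t * d0)) \<in> CM"
      by (intro CM.mult_mem A_subset_CM[OF y(1)] t_mem_CM p)
    moreover have "y * P / t ^ m \<in> K" "(x + y * Q) / t ^ m \<in> K"
      using x(1) y(1) PQ by (simp_all add: div_power_mem_K A.add_mem A.mult_mem)
    ultimately have "res (w * h) = frac_class (y * P / t ^ m * \<sigma> + (x + y * Q) / t ^ m * \<rho>)"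
      by (intro res_eq) simp_all
    moreover have "c - (y * P / t ^ m * \<sigma> + (x + y * Q) / t ^ m * \<rho>)
        = (\<xi> - x) / t ^ m * \<rho> + (\<eta> - y) / t ^ m * (P * \<sigma> + Q * \<rho>)"
    proof -
      have "c = (\<xi> * \<rho> + \<eta> * (P * \<sigma> + Q * \<rho>)) / t ^ m"
        unfolding P_def Q_def \<xi>(4) by simp
      then show ?thesis
        by (simp add: field_simps)
    qed
    moreover have "(\<xi> - x) / t ^ m * \<rho> + (\<eta> - y) / t ^ m * (P * \<sigma> + Q * \<rho>) \<in> R"
      by (intro R.add_mem R.mult_mem x y mem_R[OF PQ(1)] mem_R[OF PQ(2)] sigma_mem rho_mem)
    ultimately show ?thesis
      using c(1) frac_class_eq_iff by metis
  qed
  have "\<phi> f = res (f * h)" if f: "f \<in> CM" for f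
  proof -
    obtain \<alpha> \<beta> d where d: "\<alpha> \<in> A" "\<beta> \<in> A" "d \<in> CM" "f = \<alpha> + \<beta> * w + t ^ m * d"
      using CM_decomp[OF f] by blast
    have mem: "\<alpha> * 1 \<in> CM" "\<beta> * w \<in> CM" "t ^ m * d \<in> CM"
      using d A_subset_CM w_mem_CM t_mem_CM by (simp_all add: CM.mult_mem CM.power_mem)
    have "\<phi> f = \<phi> (\<alpha> * 1 + \<beta> * w) \<oplus>\<^bsub>frac_quotient A\<^esub> \<phi> (t ^ m * d)"
      using \<phi>_add[OF CM.add_mem[OF mem(1,2)] mem(3)] d(4) by simp
    also have "\<phi> (\<alpha> * 1 + \<beta> * w) = \<alpha> \<odot>\<^bsub>frac_quotient A\<^esub> \<phi> 1 \<oplus>\<^bsub>frac_quotient A\<^esub> \<beta> \<odot>\<^bsub>frac_quotient A\<^esub> \<phi> w"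
      using \<phi>_add[OF mem(1,2)] \<phi>_smult[OF d(1) CM.one_mem] \<phi>_smult[OF d(2) w_mem_CM] by simp
    also have "\<dots> = res (\<alpha> * h + \<beta> * (w * h))"
      unfolding res_h[symmetric] res_wh[symmetric]
      using res_add[OF L_mult[OF A_subset_CM[OF d(1)] h] L_mult[OF A_subset_CM[OF d(2)] L_mult[OF w_mem_CM h]]]
      by (simp add: res_smult[OF d(1) h] res_smult[OF d(2) L_mult[OF w_mem_CM h]])
    also have "\<phi> (t ^ m * d) = res (d * (t ^ m * h))"
      using \<phi>_vanish[OF d(3)] res_CM[OF CM.mult_mem[OF d(3) th_CM]] by simp
    also have "res (\<alpha> * h + \<beta> * (w * h)) \<oplus>\<^bsub>frac_quotient A\<^esub> res (d * (t ^ m * h))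
        = res (\<alpha> * h + \<beta> * (w * h) + d * (t ^ m * h))"
      using d h th_CM A_subset_CM
      by (intro res_add[symmetric] L_add L_mult w_mem_CM CM.power_mem t_mem_CM) simp_all
    also have "\<alpha> * h + \<beta> * (w * h) + d * (t ^ m * h) = f * h"
      by (simp add: d(4) algebra_simps)
    finally show ?thesis .
  qed
  \<comment> \<open>Outside \<open>CM\<close> both functions take the default value of extensional
    functions.\<close>
  then have "\<phi> f = (\<lambda>f\<in>CM. res (f * h)) f" for f
    using PiE_arb[OF \<phi>_ext, of f] by (cases "f \<in> CM") simp_all
  then have "\<phi> = \<Phi> (coset h)"
    unfolding Phi_coset[OF h] by (rule ext)
  then show ?thesis
    using h by (auto simp: carrier_H1)
qed

lemma Phi_iso: "\<Phi> \<in> module_isos (embedded CM) H1 Homc"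
proof -
  have "\<Phi> ` carrier H1 = carrier Homc"
  proof
    show "\<Phi> ` carrier H1 \<subseteq> carrier Homc"
      unfolding carrier_H1 using Phi_mem_Homc by blast
    show "carrier Homc \<subseteq> \<Phi> ` carrier H1"
      using Phi_surj by blast
  qed
  then show ?thesis
    using Phi_module_hom Phi_inj by (simp add: module_isos_def bij_betw_def)
qed

end

section \<open>Translation of the hypotheses\<close>

context field_subring
begin

lemma nat_pow_embedded:
  assumes "x \<in> S"
  shows "x [^]\<^bsub>embedded S\<^esub> (k::nat) = x ^ k"
proof -
  interpret cring "embedded S" by (rule cring_embedded)
  show ?thesis
    by (induction k) (simp_all add: mult.commute)
qed

text \<open>\<open>eval\<close> reads coefficient lists from the leading coefficient down,
  \<open>Poly\<close> from the constant term up; hence \<open>rev\<close>.\<close>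

lemma eval_embedded:
  assumes "x \<in> S"
  shows "ring.eval (embedded S) l x = poly (Poly (rev l)) x"
proof -
  interpret cring "embedded S" by (rule cring_embedded)
  show ?thesis
    by (induction l) (simp_all add: Poly_append poly_monom nat_pow_embedded[OF assms])
qed

text \<open>The algebraic notion is injectivity of evaluation on normalized coefficient lists; the
  list of \<open>p\<close> is compared with the empty list.\<close>

lemma transcendental_imp_poly_nonzero:
  assumes trans: "ring.transcendental (embedded S) T z" and z: "z \<in> S"
    and p: "p \<in> polys_over T" "poly p z = 0"
  shows "p = 0"
proof -
  interpret cring "embedded S" by (rule cring_embedded)
  have "polynomial\<^bsub>embedded S\<^esub> T (rev (coeffs p))"
  proof (cases "p = 0")
    case False
    have "set (coeffs p) \<subseteq> T"
      using p(1) by (auto simp: polys_over_def coeffs_def)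
    moreover have "hd (rev (coeffs p)) \<noteq> 0"
      using False by (simp add: hd_rev last_coeffs_eq_coeff_degree)
    ultimately show ?thesis
      by (simp add: polynomial_def)
  qed (simp add: polynomial_def)
  moreover have "polynomial\<^bsub>embedded S\<^esub> T []"
    by (simp add: polynomial_def)
  moreover have "eval (rev (coeffs p)) z = eval [] z"
    using p(2) by (simp add: eval_embedded[OF z])
  ultimately have "rev (coeffs p) = []"
    using trans unfolding transcendental_def univ_poly_carrier by (blast dest: inj_onD)
  then show ?thesis by simp
qed

lemma mem_PIdl_embedded: "t \<noteq> 0 \<Longrightarrow> x \<in> PIdl\<^bsub>embedded S\<^esub> t \<longleftrightarrow> x / t \<in> S"
  unfolding cgenideal_def by (auto intro!: exI[of _ "x / t"])

text \<open>A maximal zero ideal would make the ring a field.\<close>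

lemma dvr_uniformizer_nonzero:
  assumes "discrete_valuation_ring (embedded S)" "maximalideal (PIdl\<^bsub>embedded S\<^esub> t) (embedded S)"
  shows "t \<noteq> 0"
proof
  interpret cring "embedded S" by (rule cring_embedded)
  assume "t = 0"
  then have "PIdl\<^bsub>embedded S\<^esub> t = {\<zero>\<^bsub>embedded S\<^esub>}"
    unfolding cgenideal_def by (auto intro!: exI[of _ 0])
  moreover have "\<one>\<^bsub>embedded S\<^esub> \<noteq> \<zero>\<^bsub>embedded S\<^esub>"
    by simp
  ultimately have "Ring.field (embedded S)"
    using assms(2) zeromaximalideal_fieldI by simp
  then show False
    using assms(1) by (simp add: discrete_valuation_ring_def)
qed

lemma dvr_uniformizer_nonunit:
  assumes "t \<noteq> 0" "maximalideal (PIdl\<^bsub>embedded S\<^esub> t) (embedded S)"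
  shows "inverse t \<notin> S"
proof
  assume inv: "inverse t \<in> S"
  have "x / t \<in> S" if "x \<in> S" for x
    using mult_mem[OF that inv] by (simp add: divide_inverse)
  moreover have "x \<in> S" if "x \<in> PIdl\<^bsub>embedded S\<^esub> t" for x
    using that ideal.Icarr[OF maximalideal.axioms(1)[OF assms(2)]] by simp
  ultimately have "carrier (embedded S) = PIdl\<^bsub>embedded S\<^esub> t"
    using mem_PIdl_embedded[OF assms(1)] by auto
  then show False
    using maximalideal.I_notcarr[OF assms(2)] by simp
qed

text \<open>A nonzero nonunit has an irreducible divisor, whose ideal is maximal and hence equals
  that of \<open>t\<close>; so \<open>t\<close> divides it.\<close>

lemma dvr_unit:
  assumes dvr: "discrete_valuation_ring (embedded S)"
    and max: "maximalideal (PIdl\<^bsub>embedded S\<^esub> t) (embedded S)" and "t \<noteq> 0"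
    and x: "x \<in> S" "x / t \<notin> S"
  shows "inverse x \<in> S"
proof -
  interpret principal_domain "embedded S"
    using dvr by (simp add: discrete_valuation_ring_def)
  have "x \<noteq> 0"
    using x by auto
  have "x \<in> Units (embedded S)"
  proof (rule ccontr)
    assume "x \<notin> Units (embedded S)"
    with \<open>x \<noteq> 0\<close> x(1) obtain b where b: "b \<in> carrier (embedded S)"
        "ring_irreducible\<^bsub>embedded S\<^esub> b" "b divides\<^bsub>embedded S\<^esub> x"
      using exists_irreducible_divisor[of x] by (metis Diff_iff embedded_simps(1,4) singletonD)
    have "maximalideal (PIdl\<^bsub>embedded S\<^esub> b) (embedded S)"
      using b(1,2) by (rule irreducible_imp_maximalideal)
    then have "PIdl\<^bsub>embedded S\<^esub> b = PIdl\<^bsub>embedded S\<^esub> t"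
      using dvr max unfolding discrete_valuation_ring_def by blast
    moreover have "x \<in> PIdl\<^bsub>embedded S\<^esub> b"
    proof -
      obtain c where "c \<in> S" "x = c * b"
        using b(3) by (auto simp: factor_def mult.commute)
      then show ?thesis
        unfolding cgenideal_def by auto
    qed
    ultimately show False
      using mem_PIdl_embedded[OF assms(3)] x(2) by blast
  qed
  then obtain y where "y \<in> S" "y * x = 1"
    by (auto simp: Units_def)
  then show ?thesis
    using inverse_unique[of x y] by (simp add: mult.commute)
qed

lemma Units_embedded:
  assumes "x \<in> Units (embedded S)"
  shows "x \<in> S" "inverse x \<in> S" "x \<noteq> 0"
proof -
  obtain y where y: "y \<in> S" "x * y = 1"
    using assms by (auto simp: Units_def)
  then show "x \<noteq> 0" "inverse x \<in> S"
    using inverse_unique[of x y] by auto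
  show "x \<in> S"
    using assms by (simp add: Units_def)
qed

end

lemma complete_dvrI:
  assumes dvr: "discrete_valuation_ring (embedded A)"
    and t: "t \<in> A" "maximalideal (PIdl\<^bsub>embedded A\<^esub> t) (embedded A)"
    and completion: "is_adic_completion A t Ahat"
    and ambient: "fractions Ahat = UNIV"
  shows "complete_dvr A Ahat t"
proof -
  have comp: "subring Ahat (embedded UNIV)" "subring A (embedded Ahat)"
    "\<And>k. adic_nbhd t k Ahat \<inter> A = adic_nbhd t k A"
    "(\<Inter>k. adic_nbhd t k Ahat) = {0}"
    "\<And>x k. x \<in> Ahat \<Longrightarrow> \<exists>y\<in>A. x - y \<in> adic_nbhd t k Ahat"
    "\<And>u. adic_Cauchy Ahat t u \<Longrightarrow> \<exists>l. adic_lim Ahat t u l"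
    using completion unfolding is_adic_completion_def by blast+
  interpret R: field_subring Ahat
    using comp(1) field_subring_UNIV by (rule field_subringI)
  interpret A: field_subring A
    using comp(2) R.field_subring_axioms by (rule field_subringI)
  have nz: "t \<noteq> 0"
    using dvr t(2) by (rule A.dvr_uniformizer_nonzero)
  note nbhd = mem_adic_nbhd_iff[OF nz]
  show ?thesis
  proof
    show "A \<subseteq> Ahat"
      using subringE(1)[OF comp(2)] by simp
    show "inverse t \<notin> A"
      using nz t(2) by (rule A.dvr_uniformizer_nonunit)
    show "inverse x \<in> A" if "x \<in> A" "x / t \<notin> A" for x
      using dvr t(2) nz that by (rule A.dvr_unit)
    show "x / t \<in> A" if "x \<in> A" "x / t \<in> Ahat" for x
    proof -
      have "x \<in> adic_nbhd t 1 Ahat \<inter> A"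
        using that by (simp add: nbhd)
      then have "x \<in> adic_nbhd t 1 A"
        by (simp only: comp(3))
      then show ?thesis
        by (simp add: nbhd)
    qed
    show "x = 0" if "\<And>k. x / t ^ k \<in> Ahat" for x
    proof -
      have "x \<in> (\<Inter>k. adic_nbhd t k Ahat)"
        using that by (simp add: nbhd)
      then show ?thesis
        using comp(4) by simp
    qed
    show "\<exists>y\<in>A. (x - y) / t ^ k \<in> Ahat" if "x \<in> Ahat" for x k
      using comp(5)[OF that, of k] by (simp add: nbhd)
  qed (use t(1) nz comp(6) ambient in simp_all)
qed

theorem mainTheorem1:
  fixes A Ahat :: "'k::field set" and t z \<sigma> \<rho> :: 'k
    and a :: "nat \<Rightarrow> 'k" and n :: "nat \<Rightarrow> nat"
  assumes dvr: "discrete_valuation_ring (embedded A)"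
    and uniformizer: "t \<in> A" "maximalideal (PIdl\<^bsub>embedded A\<^esub> t) (embedded A)"
    and completion: "is_adic_completion A t Ahat"
    and ambient: "fractions Ahat = UNIV"
    and coeffs: "\<And>i. a i \<in> A - PIdl\<^bsub>embedded A\<^esub> t"
    and expansion: "z \<in> Ahat" "adic_sums Ahat t (\<lambda>i. a i * t ^ n i) z"
    and transc: "ring.transcendental (embedded Ahat) A z"
    and exps: "n 0 = 0" "\<And>r. r \<ge> 1 \<Longrightarrow> n r \<ge> 2 * n (r - 1) + 2"
    and sigma: "\<sigma> \<in> Ahat"
    and rho: "\<rho> \<in> Units (embedded Ahat)"
  shows "akizuki_Phi A Ahat t a n \<sigma> \<rho>
           \<in> module_isos (embedded (akizuki_CM A Ahat t a n))
               (akizuki_H1 A Ahat t a n) (akizuki_Homc A Ahat t a n)"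
proof -
  interpret complete_dvr A Ahat t
    using dvr uniformizer completion ambient by (rule complete_dvrI)
  interpret akizuki_residue A Ahat t a n z \<sigma> \<rho>
  proof
    show "a i \<in> A" for i
      using coeffs by blast
    show "p = 0" if "p \<in> polys_over A" "poly p z = 0" for p
      using transc expansion(1) that by (rule R.transcendental_imp_poly_nonzero)
    show "2 * n r + 2 \<le> n (Suc r)" for r
      using exps(2)[of "Suc r"] by simp
  qed (use expansion exps(1) sigma R.Units_embedded[OF rho] in simp_all)
  show ?thesis
    by (rule Phi_iso)
qed

end
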